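(* Let $(M^{2n},J)$ be a compact almost complex manifold of real dimension $2n$. Then the following three statements about the given $J$ are equivalent: (a) if there exists a symplectic form on $M$ taming $J$, then there exists a symplectic form on $M$ compatible with $J$; (b) either $d\Omega_J^-\cap d\Omega_J^{\oplus}=\emptyset$ or $d\Omega_J^{\oplus}=d\Omega_J^+$; (c) for every $\alpha\in\Omega_J^-$, if $d\alpha\in d\Omega_J^{\oplus}$, then $d(-\alpha)\in d\Omega_J^{\oplus}$.
   Context: Manifolds are smooth and without boundary, and $J$ is a smooth almost complex structure (not assumed integrable). $\Omega^2$ is the space of real $C^\infty$ $2$-forms on $M$. $J$ acts on $\Omega^2$ as the involution $\alpha(\cdot,\cdot)\mapsto \alpha(J\cdot,J\cdot)$, which gives the splitting $\Omega^2=\Omega_J^+\oplus\Omega_J^-$ into $J$-invariant forms ($\alpha(J\cdot,J\cdot)=\alpha$) and $J$-anti-invariant forms ($\alpha(J\cdot,J\cdot)=-\alpha$). $\Omega_J^{\oplus}\subset\Omega_J^+$ denotes the cone of $J$-invariant, $J$-positive forms, i.e. the forms $\omega\in\Omega^2$ such that $\omega(\cdot,J\cdot)$ defines a Riemannian metric on $M$; elements of $\Omega_J^{\oplus}$ need not be closed. For a set $S$ of $2$-forms, $dS=\{d\sigma:\sigma\in S\}$ is its image under the exterior derivative. A symplectic form is a closed nondegenerate $2$-form. A symplectic form $\omega$ tames $J$ if it is $J$-positive: $\omega(X,JX)>0$ for all nonzero $X\in TM$. A symplectic form $\omega$ is compatible with $J$ if it is $J$-positive and $J$-invariant, i.e.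 also $\omega(JY,JZ)=\omega(Y,Z)$ for all tangent vectors $Y,Z$ at the same point. *)

theory Defs
  imports "HOL-Analysis.Analysis"
begin

section \<open>Smooth maps between Euclidean spaces\<close>

primrec k_smooth_on ::
    "nat \<Rightarrow> 'a::real_normed_vector set \<Rightarrow> ('a \<Rightarrow> 'b::real_normed_vector) \<Rightarrow> bool" where
  "k_smooth_on 0 S f \<longleftrightarrow> continuous_on S f"
| "k_smooth_on (Suc k) S f \<longleftrightarrow>
     (\<forall>x\<in>S. f differentiable (at x)) \<and>
     (\<forall>v. k_smooth_on k S (\<lambda>x. frechet_derivative f (at x) v))"

text \<open>Only used for open \<open>S\<close>, where it depends only on the restriction of \<open>f\<close> to \<open>S\<close>.\<close>

definition smooth_on ::
    "'a::real_normed_vector set \<Rightarrow> ('a \<Rightarrow> 'b::real_normed_vector) \<Rightarrow> bool" where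
  "smooth_on S f \<longleftrightarrow> (\<forall>k. k_smooth_on k S f)"


section \<open>Smooth manifolds\<close>

text \<open>A chart \<open>(U, \<phi>)\<close> consists of its domain and a map of which only the values on \<open>U\<close> matter.\<close>

type_synonym ('m, 'e) chart = "'m set \<times> ('m \<Rightarrow> 'e)"

definition chart_inv :: "('m, 'e) chart \<Rightarrow> 'e \<Rightarrow> 'm" where
  "chart_inv c = inv_into (fst c) (snd c)"

definition transition :: "('m, 'e) chart \<Rightarrow> ('m, 'e) chart \<Rightarrow> 'e \<Rightarrow> 'e" where
  "transition c c' = snd c' \<circ> chart_inv c"

text \<open>
  The points of the manifold form \<open>topspace X\<close>, and \<open>A\<close> is an atlas, not required to be
  maximal, modelled on \<open>'e\<close>: every smooth structure is given by some atlas, and the notions below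
  are the same for all atlases of one smooth structure.
\<close>

definition smooth_manifold :: "'m topology \<Rightarrow> ('m, 'e::euclidean_space) chart set \<Rightarrow> bool" where
  "smooth_manifold X A \<longleftrightarrow>
     Hausdorff_space X \<and> second_countable X \<and>
     (\<Union>c\<in>A. fst c) = topspace X \<and>
     (\<forall>c\<in>A. openin X (fst c) \<and> open (snd c ` fst c) \<and>
        homeomorphic_map (subtopology X (fst c)) (top_of_set (snd c ` fst c)) (snd c)) \<and>
     (\<forall>c\<in>A. \<forall>c'\<in>A. smooth_on (snd c ` (fst c \<inter> fst c')) (transition c c'))"

definition points :: "('m, 'e) chart set \<Rightarrow> 'm set" where
  "points A = (\<Union>c\<in>A. fst c)"

definition charts_at :: "('m, 'e) chart set \<Rightarrow> 'm \<Rightarrow> ('m, 'e) chart set" where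
  "charts_at A p = {c\<in>A. p \<in> fst c}"


section \<open>Tangent vectors\<close>

text \<open>
  A tangent vector at \<open>p\<close> is the family of its coordinate vectors in all the charts around \<open>p\<close>,
  related by the derivatives of the transition maps. The value at a chart not around \<open>p\<close> is
  fixed to be \<open>0\<close>, so that distinct functions are distinct tangent vectors. The vector space
  operations are pointwise.
\<close>

type_synonym ('m, 'e) tvec = "('m, 'e) chart \<Rightarrow> 'e"

definition tangent_space ::
    "('m, 'e::euclidean_space) chart set \<Rightarrow> 'm \<Rightarrow> ('m, 'e) tvec set" where
  "tangent_space A p =
     {v. (\<forall>c\<in>charts_at A p. \<forall>c'\<in>charts_at A p.
            v c' = frechet_derivative (transition c c') (at (snd c p)) (v c)) \<and>
         (\<forall>c. c \<notin> charts_at A p \<longrightarrow> v c = 0)}"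

definition tzero :: "('m, 'e::euclidean_space) tvec" where
  "tzero = (\<lambda>c. 0)"

definition tcomb ::
    "real \<Rightarrow> ('m, 'e::euclidean_space) tvec \<Rightarrow> real \<Rightarrow> ('m, 'e) tvec \<Rightarrow> ('m, 'e) tvec" where
  "tcomb a u b v = (\<lambda>c. a *\<^sub>R u c + b *\<^sub>R v c)"

text \<open>The tangent vector at \<open>p\<close> whose coordinate vector in the chart \<open>c\<close> is \<open>e\<close>.\<close>

definition tvec_of ::
    "('m, 'e::euclidean_space) chart set \<Rightarrow> ('m, 'e) chart \<Rightarrow> 'm \<Rightarrow> 'e \<Rightarrow> ('m, 'e) tvec" where
  "tvec_of A c p e =
     (\<lambda>c'. if c' \<in> charts_at A p
           then frechet_derivative (transition c c') (at (snd c p)) e else 0)"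


section \<open>Covariant 2-tensors and differential 2-forms\<close>

type_synonym ('m, 'e) tensor2 = "'m \<Rightarrow> ('m, 'e) tvec \<Rightarrow> ('m, 'e) tvec \<Rightarrow> real"
type_synonym ('m, 'e) tensor3 =
  "'m \<Rightarrow> ('m, 'e) tvec \<Rightarrow> ('m, 'e) tvec \<Rightarrow> ('m, 'e) tvec \<Rightarrow> real"

text \<open>The representative of \<open>g\<close> in the chart \<open>c\<close>, at \<open>x\<close> in the image of \<open>c\<close>.\<close>

definition local_tensor ::
    "('m, 'e::euclidean_space) chart set \<Rightarrow> ('m, 'e) tensor2 \<Rightarrow> ('m, 'e) chart \<Rightarrow>
     'e \<Rightarrow> 'e \<Rightarrow> 'e \<Rightarrow> real" where
  "local_tensor A g c x a b =
     g (chart_inv c x) (tvec_of A c (chart_inv c x) a) (tvec_of A c (chart_inv c x) b)"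

definition smooth_tensor2 ::
    "('m, 'e::euclidean_space) chart set \<Rightarrow> ('m, 'e) tensor2 \<Rightarrow> bool" where
  "smooth_tensor2 A g \<longleftrightarrow>
     (\<forall>p\<in>points A. \<forall>u\<in>tangent_space A p. \<forall>v\<in>tangent_space A p. \<forall>w\<in>tangent_space A p. \<forall>a b.
        g p (tcomb a u b v) w = a * g p u w + b * g p v w \<and>
        g p w (tcomb a u b v) = a * g p w u + b * g p w v) \<and>
     (\<forall>c\<in>A. \<forall>a b. smooth_on (snd c ` fst c) (\<lambda>x. local_tensor A g c x a b))"

text \<open>
  The last condition removes the junk values of a form off its domain, so that equality of forms
  is equality of functions.
\<close>

definition Omega2 :: "('m, 'e::euclidean_space) chart set \<Rightarrow> ('m, 'e) tensor2 set" where
  "Omega2 A =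
     {\<omega>. smooth_tensor2 A \<omega> \<and>
         (\<forall>p\<in>points A. \<forall>u\<in>tangent_space A p. \<forall>v\<in>tangent_space A p. \<omega> p u v = - \<omega> p v u) \<and>
         (\<forall>p u v. \<not> (p \<in> points A \<and> u \<in> tangent_space A p \<and> v \<in> tangent_space A p) \<longrightarrow>
            \<omega> p u v = 0)}"

definition riemannian_metric ::
    "('m, 'e::euclidean_space) chart set \<Rightarrow> ('m, 'e) tensor2 \<Rightarrow> bool" where
  "riemannian_metric A g \<longleftrightarrow>
     smooth_tensor2 A g \<and>
     (\<forall>p\<in>points A. \<forall>u\<in>tangent_space A p. \<forall>v\<in>tangent_space A p. g p u v = g p v u) \<and>
     (\<forall>p\<in>points A. \<forall>u\<in>tangent_space A p. u \<noteq> tzero \<longrightarrow> g p u u > 0)"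


section \<open>The exterior derivative of a 2-form\<close>

text \<open>
  In a chart, for constant vector fields \<open>u, v, w\<close>, the exterior derivative of a 2-form is
  \<open>d\<omega>(u,v,w) = u(\<omega>(v,w)) - v(\<omega>(u,w)) + w(\<omega>(u,v))\<close>.
\<close>

definition ext_deriv_in ::
    "('m, 'e::euclidean_space) chart set \<Rightarrow> ('m, 'e) chart \<Rightarrow> ('m, 'e) tensor2 \<Rightarrow>
     ('m, 'e) tensor3" where
  "ext_deriv_in A c \<omega> p u v w =
     (let D = \<lambda>a b e. frechet_derivative (\<lambda>x. local_tensor A \<omega> c x b e) (at (snd c p)) a
      in D (u c) (v c) (w c) - D (v c) (u c) (w c) + D (w c) (u c) (v c))"

text \<open>For \<open>\<omega>\<close> in \<open>Omega2 A\<close> the choice of the chart does not matter; see \<open>ext_deriv_eq\<close> below.\<close>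

definition ext_deriv ::
    "('m, 'e::euclidean_space) chart set \<Rightarrow> ('m, 'e) tensor2 \<Rightarrow> ('m, 'e) tensor3" where
  "ext_deriv A \<omega> p u v w =
     (if p \<in> points A \<and> u \<in> tangent_space A p \<and> v \<in> tangent_space A p \<and> w \<in> tangent_space A p
      then ext_deriv_in A (SOME c. c \<in> charts_at A p) \<omega> p u v w
      else 0)"


section \<open>Symplectic forms and almost complex structures\<close>

definition symplectic_form ::
    "('m, 'e::euclidean_space) chart set \<Rightarrow> ('m, 'e) tensor2 \<Rightarrow> bool" where
  "symplectic_form A \<omega> \<longleftrightarrow>
     \<omega> \<in> Omega2 A \<and> ext_deriv A \<omega> = (\<lambda>p u v w. 0) \<and>
     (\<forall>p\<in>points A. \<forall>u\<in>tangent_space A p. (\<forall>v\<in>tangent_space A p. \<omega> p u v = 0) \<longrightarrow> u = tzero)"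

type_synonym ('m, 'e) endo = "'m \<Rightarrow> ('m, 'e) tvec \<Rightarrow> ('m, 'e) tvec"

definition almost_complex_structure ::
    "('m, 'e::euclidean_space) chart set \<Rightarrow> ('m, 'e) endo \<Rightarrow> bool" where
  "almost_complex_structure A J \<longleftrightarrow>
     (\<forall>p\<in>points A. \<forall>u\<in>tangent_space A p.
        J p u \<in> tangent_space A p \<and> J p (J p u) = (\<lambda>c. - u c) \<and>
        (\<forall>v\<in>tangent_space A p. \<forall>a b. J p (tcomb a u b v) = tcomb a (J p u) b (J p v))) \<and>
     (\<forall>c\<in>A. \<forall>e. smooth_on (snd c ` fst c)
        (\<lambda>x. J (chart_inv c x) (tvec_of A c (chart_inv c x) e) c))"

definition J_invariant ::
    "('m, 'e::euclidean_space) chart set \<Rightarrow> ('m, 'e) endo \<Rightarrow> ('m, 'e) tensor2 \<Rightarrow> bool" where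
  "J_invariant A J \<alpha> \<longleftrightarrow>
     (\<forall>p\<in>points A. \<forall>u\<in>tangent_space A p. \<forall>v\<in>tangent_space A p. \<alpha> p (J p u) (J p v) = \<alpha> p u v)"

definition J_antiinvariant ::
    "('m, 'e::euclidean_space) chart set \<Rightarrow> ('m, 'e) endo \<Rightarrow> ('m, 'e) tensor2 \<Rightarrow> bool" where
  "J_antiinvariant A J \<alpha> \<longleftrightarrow>
     (\<forall>p\<in>points A. \<forall>u\<in>tangent_space A p. \<forall>v\<in>tangent_space A p. \<alpha> p (J p u) (J p v) = - \<alpha> p u v)"

definition J_positive ::
    "('m, 'e::euclidean_space) chart set \<Rightarrow> ('m, 'e) endo \<Rightarrow> ('m, 'e) tensor2 \<Rightarrow> bool" where
  "J_positive A J \<omega> \<longleftrightarrow>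
     (\<forall>p\<in>points A. \<forall>u\<in>tangent_space A p. u \<noteq> tzero \<longrightarrow> \<omega> p u (J p u) > 0)"

definition Omega_plus ::
    "('m, 'e::euclidean_space) chart set \<Rightarrow> ('m, 'e) endo \<Rightarrow> ('m, 'e) tensor2 set" where
  "Omega_plus A J = {\<alpha> \<in> Omega2 A. J_invariant A J \<alpha>}"

definition Omega_minus ::
    "('m, 'e::euclidean_space) chart set \<Rightarrow> ('m, 'e) endo \<Rightarrow> ('m, 'e) tensor2 set" where
  "Omega_minus A J = {\<alpha> \<in> Omega2 A. J_antiinvariant A J \<alpha>}"

text \<open>
  Such an \<open>\<omega>\<close> is automatically \<open>J\<close>-invariant, by the symmetry of the metric; see
  \<open>Omega_oplus_subset\<close>.
\<close>

definition Omega_oplus ::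
    "('m, 'e::euclidean_space) chart set \<Rightarrow> ('m, 'e) endo \<Rightarrow> ('m, 'e) tensor2 set" where
  "Omega_oplus A J = {\<omega> \<in> Omega2 A. riemannian_metric A (\<lambda>p u v. \<omega> p u (J p v))}"

definition tames ::
    "('m, 'e::euclidean_space) chart set \<Rightarrow> ('m, 'e) endo \<Rightarrow> ('m, 'e) tensor2 \<Rightarrow> bool" where
  "tames A J \<omega> \<longleftrightarrow> symplectic_form A \<omega> \<and> J_positive A J \<omega>"

definition compatible ::
    "('m, 'e::euclidean_space) chart set \<Rightarrow> ('m, 'e) endo \<Rightarrow> ('m, 'e) tensor2 \<Rightarrow> bool" where
  "compatible A J \<omega> \<longleftrightarrow> symplectic_form A \<omega> \<and> J_positive A J \<omega> \<and> J_invariant A J \<omega>"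

lemma Omega_oplus_subset:
  assumes J: "almost_complex_structure A J"
  shows "Omega_oplus A J \<subseteq> {\<omega> \<in> Omega_plus A J. J_positive A J \<omega>}"
proof
  fix \<omega> assume o: "\<omega> \<in> Omega_oplus A J"
  have o2: "\<omega> \<in> Omega2 A" and m: "riemannian_metric A (\<lambda>p u v. \<omega> p u (J p v))"
    using o by (simp_all add: Omega_oplus_def)
  have "\<omega> p (J p u) (J p v) = \<omega> p u v"
    if p: "p \<in> points A" and u: "u \<in> tangent_space A p" and v: "v \<in> tangent_space A p" for p u v
  proof -
    have Ju: "J p u \<in> tangent_space A p" and "J p (J p u) = (\<lambda>c. - u c)"
      using J p u unfolding almost_complex_structure_def by blast+
    then have JJu: "J p (J p u) = tcomb (-1) u 0 u"
      by (simp add: tcomb_def)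
    have "\<omega> p (J p u) (J p v) = \<omega> p v (J p (J p u))"
      using m p Ju v unfolding riemannian_metric_def by blast
    also have "\<dots> = (-1) * \<omega> p v u + 0 * \<omega> p v u"
    proof -
      have "smooth_tensor2 A \<omega>"
        using o2 by (simp add: Omega2_def)
      then have "\<forall>p\<in>points A. \<forall>u\<in>tangent_space A p. \<forall>v\<in>tangent_space A p. \<forall>w\<in>tangent_space A p.
          \<forall>a b. \<omega> p w (tcomb a u b v) = a * \<omega> p w u + b * \<omega> p w v"
        unfolding smooth_tensor2_def by blast
      then show ?thesis
        unfolding JJu using p u v by blast
    qed
    also have "\<dots> = - \<omega> p v u" by simp
    also have "\<dots> = \<omega> p u v"
    proof -
      have "\<omega> p u v = - \<omega> p v u"
        using o2 p u v unfolding Omega2_def by blast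
      then show ?thesis by simp
    qed
    finally show ?thesis .
  qed
  then have "J_invariant A J \<omega>"
    unfolding J_invariant_def by blast
  moreover have "J_positive A J \<omega>"
    using m unfolding J_positive_def riemannian_metric_def by blast
  ultimately show "\<omega> \<in> {\<omega> \<in> Omega_plus A J. J_positive A J \<omega>}"
    using o2 by (simp add: Omega_plus_def)
qed

section \<open>The exterior derivative does not depend on the chart\<close>

lemma smooth_on_continuous: "smooth_on S f \<Longrightarrow> continuous_on S f"
  unfolding smooth_on_def by (metis k_smooth_on.simps(1))

lemma smooth_on_differentiable: "smooth_on S f \<Longrightarrow> x \<in> S \<Longrightarrow> f differentiable (at x)"
  unfolding smooth_on_def by (metis k_smooth_on.simps(2))

lemma smooth_on_deriv: "smooth_on S f \<Longrightarrow> smooth_on S (\<lambda>x. frechet_derivative f (at x) v)"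
  unfolding smooth_on_def by (metis k_smooth_on.simps(2))

lemma has_derivative_frechet:
  "f differentiable (at x) \<Longrightarrow> (f has_derivative frechet_derivative f (at x)) (at x)"
  by (simp add: frechet_derivative_works)

lemma line_derivative:
  fixes f :: "'a::real_normed_vector \<Rightarrow> real"
  assumes "f differentiable (at (p + s *\<^sub>R u))"
  shows "((\<lambda>s. f (p + s *\<^sub>R u)) has_real_derivative
          frechet_derivative f (at (p + s *\<^sub>R u)) u) (at s)"
proof -
  let ?D = "frechet_derivative f (at (p + s *\<^sub>R u))"
  have lin: "linear ?D"
    using assms by (rule linear_frechet_derivative)
  have "((\<lambda>s. p + s *\<^sub>R u) has_derivative (\<lambda>t. t *\<^sub>R u)) (at s)"
    by (auto intro!: derivative_eq_intros)
  then have "((\<lambda>s. f (p + s *\<^sub>R u)) has_derivative (\<lambda>t. ?D (t *\<^sub>R u))) (at s)"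
    by (rule has_derivative_compose[where g = f]) (rule has_derivative_frechet[OF assms])
  moreover have "(\<lambda>t. ?D (t *\<^sub>R u)) = (*) (?D u)"
    using linear_scale[OF lin] by (auto simp: mult.commute)
  ultimately show ?thesis
    by (simp add: has_field_derivative_def)
qed

lemma second_difference:
  fixes f :: "'a::real_normed_vector \<Rightarrow> real"
  assumes h: "h > 0"
    and S: "\<And>s t. 0 \<le> s \<Longrightarrow> s \<le> h \<Longrightarrow> 0 \<le> t \<Longrightarrow> t \<le> h \<Longrightarrow> x + s *\<^sub>R u + t *\<^sub>R w \<in> S"
    and D1: "\<And>y. y \<in> S \<Longrightarrow> f differentiable (at y)"
    and D2: "\<And>y. y \<in> S \<Longrightarrow> (\<lambda>z. frechet_derivative f (at z) u) differentiable (at y)"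
  shows "\<exists>s t. 0 < s \<and> s < h \<and> 0 < t \<and> t < h \<and>
    f (x + h *\<^sub>R u + h *\<^sub>R w) - f (x + h *\<^sub>R u) - f (x + h *\<^sub>R w) + f x =
    h * (h * frechet_derivative (\<lambda>z. frechet_derivative f (at z) u) (at (x + s *\<^sub>R u + t *\<^sub>R w)) w)"
proof -
  let ?f' = "\<lambda>z. frechet_derivative f (at z) u"
  let ?g = "\<lambda>s. f ((x + h *\<^sub>R w) + s *\<^sub>R u) - f (x + s *\<^sub>R u)"
  have "DERIV ?g s :> ?f' ((x + h *\<^sub>R w) + s *\<^sub>R u) - ?f' (x + s *\<^sub>R u)"
    if s: "0 \<le> s" "s \<le> h" for s
  proof (intro derivative_intros line_derivative D1)
    show "x + h *\<^sub>R w + s *\<^sub>R u \<in> S" using S[OF s, of h] h by (simp add: algebra_simps)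
    show "x + s *\<^sub>R u \<in> S" using S[OF s, of 0] h by simp
  qed
  then obtain s where s: "0 < s" "s < h"
    and 1: "?g h - ?g 0 = (h - 0) * (?f' ((x + h *\<^sub>R w) + s *\<^sub>R u) - ?f' (x + s *\<^sub>R u))"
    using MVT2[OF h, of ?g "\<lambda>s. ?f' ((x + h *\<^sub>R w) + s *\<^sub>R u) - ?f' (x + s *\<^sub>R u)"] by blast
  have "DERIV (\<lambda>t. ?f' ((x + s *\<^sub>R u) + t *\<^sub>R w)) t :>
      frechet_derivative ?f' (at ((x + s *\<^sub>R u) + t *\<^sub>R w)) w" if "0 \<le> t" "t \<le> h" for t
    by (intro line_derivative D2) (use S[of s t] s that in simp)
  then obtain t where t: "0 < t" "t < h"
    and 2: "?f' ((x + s *\<^sub>R u) + h *\<^sub>R w) - ?f' ((x + s *\<^sub>R u) + 0 *\<^sub>R w) =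
      (h - 0) * frechet_derivative ?f' (at ((x + s *\<^sub>R u) + t *\<^sub>R w)) w"
    using MVT2[OF h, of "\<lambda>t. ?f' ((x + s *\<^sub>R u) + t *\<^sub>R w)"
      "\<lambda>t. frechet_derivative ?f' (at ((x + s *\<^sub>R u) + t *\<^sub>R w)) w"] by blast
  have "x + h *\<^sub>R w + s *\<^sub>R u = x + s *\<^sub>R u + h *\<^sub>R w"
    by (simp add: algebra_simps)
  then have "?g h - ?g 0 = h * (h * frechet_derivative ?f' (at (x + s *\<^sub>R u + t *\<^sub>R w)) w)"
    using 1 2 by (simp only: scale_zero_left add_0_right diff_0_right)
  moreover have "?g h - ?g 0 =
      f (x + h *\<^sub>R u + h *\<^sub>R w) - f (x + h *\<^sub>R u) - f (x + h *\<^sub>R w) + f x"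
    by (simp add: algebra_simps)
  ultimately have "f (x + h *\<^sub>R u + h *\<^sub>R w) - f (x + h *\<^sub>R u) - f (x + h *\<^sub>R w) + f x =
      h * (h * frechet_derivative ?f' (at (x + s *\<^sub>R u + t *\<^sub>R w)) w)"
    by (rule trans[OF sym, rotated])
  then show ?thesis
    by (intro exI[of _ s] exI[of _ t] conjI s t)
qed

lemma second_derivative_symmetric_real:
  fixes f :: "'a::real_normed_vector \<Rightarrow> real"
  assumes S: "open S" "x \<in> S" and f: "smooth_on S f"
  shows "frechet_derivative (\<lambda>z. frechet_derivative f (at z) u) (at x) w =
         frechet_derivative (\<lambda>z. frechet_derivative f (at z) w) (at x) u"
proof (rule ccontr)
  define L where "L = (\<lambda>u w y. frechet_derivative (\<lambda>z. frechet_derivative f (at z) u) (at y) w)"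
  assume "\<not> ?thesis"
  then have e: "\<bar>L u w x - L w u x\<bar> / 2 > 0" (is "?e > 0") by (simp add: L_def)
  have "continuous_on S (L u w)" "continuous_on S (L w u)"
    unfolding L_def by (intro smooth_on_continuous smooth_on_deriv f)+
  then have "isCont (L u w) x" "isCont (L w u) x"
    using S continuous_on_eq_continuous_at by blast+
  then have "\<exists>d>0. \<forall>y. dist y x < d \<longrightarrow> dist (L u w y) (L u w x) < ?e"
    "\<exists>d>0. \<forall>y. dist y x < d \<longrightarrow> dist (L w u y) (L w u x) < ?e"
    unfolding continuous_at_eps_delta using e by blast+
  then obtain d1 d2 where d: "d1 > 0" "\<And>y. dist y x < d1 \<Longrightarrow> dist (L u w y) (L u w x) < ?e"
    "d2 > 0" "\<And>y. dist y x < d2 \<Longrightarrow> dist (L w u y) (L w u x) < ?e"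
    by blast
  obtain d3 where d3: "d3 > 0" "ball x d3 \<subseteq> S"
    using S open_contains_ball by blast
  define r where "r = min d1 (min d2 d3)"
  have r: "r > 0" using d d3 by (simp add: r_def)
  define h where "h = r / (norm u + norm w + 1)"
  have h: "h > 0" and hr: "h * (norm u + norm w) < r"
  proof -
    have "norm u + norm w + 1 > 0" by (smt (verit) norm_ge_zero)
    then show "h > 0" "h * (norm u + norm w) < r"
      using r unfolding h_def by (auto simp: field_simps)
  qed
  have near: "dist (x + s *\<^sub>R u + t *\<^sub>R w) x < r" if "0 \<le> s" "s \<le> h" "0 \<le> t" "t \<le> h" for s t
  proof -
    have "norm (s *\<^sub>R u + t *\<^sub>R w) \<le> s * norm u + t * norm w"
      using norm_triangle_ineq[of "s *\<^sub>R u" "t *\<^sub>R w"] that by simp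
    also have "\<dots> \<le> h * norm u + h * norm w"
      using that by (intro add_mono mult_right_mono) auto
    also have "\<dots> < r" using hr by (simp add: algebra_simps)
    finally show ?thesis by (simp add: dist_norm algebra_simps)
  qed
  have near': "dist (x + s *\<^sub>R w + t *\<^sub>R u) x < r" if "0 \<le> s" "s \<le> h" "0 \<le> t" "t \<le> h" for s t
    using near[of t s] that by (simp add: algebra_simps)
  have inS: "y \<in> S" if "dist y x < r" for y
    using that d3 by (auto simp: r_def dist_commute subset_iff)
  have D: "\<And>y. y \<in> S \<Longrightarrow> f differentiable (at y)"
    "\<And>y v. y \<in> S \<Longrightarrow> (\<lambda>z. frechet_derivative f (at z) v) differentiable (at y)"
    by (erule smooth_on_differentiable[OF f] smooth_on_differentiable[OF smooth_on_deriv[OF f]])+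
  have "\<exists>s t. 0 < s \<and> s < h \<and> 0 < t \<and> t < h \<and>
      f (x + h *\<^sub>R u + h *\<^sub>R w) - f (x + h *\<^sub>R u) - f (x + h *\<^sub>R w) + f x =
      h * (h * L u w (x + s *\<^sub>R u + t *\<^sub>R w))"
    unfolding L_def using D by (intro second_difference[OF h, where S = S]) (auto intro: inS near)
  then obtain s t where st: "0 < s" "s < h" "0 < t" "t < h"
    "f (x + h *\<^sub>R u + h *\<^sub>R w) - f (x + h *\<^sub>R u) - f (x + h *\<^sub>R w) + f x =
     h * (h * L u w (x + s *\<^sub>R u + t *\<^sub>R w))"
    by (elim exE conjE) (rule that)
  have "\<exists>s t. 0 < s \<and> s < h \<and> 0 < t \<and> t < h \<and>
      f (x + h *\<^sub>R w + h *\<^sub>R u) - f (x + h *\<^sub>R w) - f (x + h *\<^sub>R u) + f x =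
      h * (h * L w u (x + s *\<^sub>R w + t *\<^sub>R u))"
    unfolding L_def using D by (intro second_difference[OF h, where S = S]) (auto intro: inS near')
  then obtain s' t' where st': "0 < s'" "s' < h" "0 < t'" "t' < h"
    "f (x + h *\<^sub>R w + h *\<^sub>R u) - f (x + h *\<^sub>R w) - f (x + h *\<^sub>R u) + f x =
     h * (h * L w u (x + s' *\<^sub>R w + t' *\<^sub>R u))"
    by (elim exE conjE) (rule that)
  have swap: "x + h *\<^sub>R u + h *\<^sub>R w = x + h *\<^sub>R w + h *\<^sub>R u" by (simp add: algebra_simps)
  have "h * (h * L u w (x + s *\<^sub>R u + t *\<^sub>R w)) =
      f (x + h *\<^sub>R w + h *\<^sub>R u) - f (x + h *\<^sub>R w) - f (x + h *\<^sub>R u) + f x"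
    unfolding st(5)[symmetric] swap by simp
  also have "\<dots> = h * (h * L w u (x + s' *\<^sub>R w + t' *\<^sub>R u))"
    by (rule st'(5))
  finally have "h * (h * L u w (x + s *\<^sub>R u + t *\<^sub>R w)) = h * (h * L w u (x + s' *\<^sub>R w + t' *\<^sub>R u))" .
  then have e1: "L u w (x + s *\<^sub>R u + t *\<^sub>R w) = L w u (x + s' *\<^sub>R w + t' *\<^sub>R u)"
    using h by simp
  have e2: "dist (L u w (x + s *\<^sub>R u + t *\<^sub>R w)) (L u w x) < ?e"
    using near[of s t] st by (intro d(2)) (simp add: r_def)
  have e3: "dist (L w u (x + s' *\<^sub>R w + t' *\<^sub>R u)) (L w u x) < ?e"
    using near'[of s' t'] st' by (intro d(4)) (simp add: r_def)
  have *: False if "z = z'" "dist z a < \<bar>a - b\<bar> / 2" "dist z' b < \<bar>a - b\<bar> / 2" for z z' a b :: real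
    using that by (simp add: dist_real_def abs_if split: if_splits)
  show False
    by (rule *[OF e1 e2 e3])
qed

lemma frechet_derivative_inner:
  fixes f :: "'a::real_normed_vector \<Rightarrow> 'b::euclidean_space"
  assumes "f differentiable (at x)"
  shows "frechet_derivative (\<lambda>y. f y \<bullet> i) (at x) = (\<lambda>v. frechet_derivative f (at x) v \<bullet> i)"
  by (rule frechet_derivative_at[OF has_derivative_inner_left[OF has_derivative_frechet[OF assms]], symmetric])

lemma frechet_derivative_cong_open:
  assumes "open S" "x \<in> S" "\<And>y. y \<in> S \<Longrightarrow> f y = g y"
  shows "frechet_derivative f (at x) = frechet_derivative g (at x)"
proof -
  have "(f has_derivative D) (at x) \<longleftrightarrow> (g has_derivative D) (at x)" for D
    using has_derivative_transform_within_open[of f D x UNIV S g]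
      has_derivative_transform_within_open[of g D x UNIV S f] assms by auto
  then show ?thesis by (simp add: frechet_derivative_def)
qed

lemma k_smooth_on_cong:
  assumes "open S" "\<And>y. y \<in> S \<Longrightarrow> f y = g y" "k_smooth_on k S f"
  shows "k_smooth_on k S g"
  using assms(2,3)
proof (induction k arbitrary: f g)
  case 0
  then show ?case by (simp cong: continuous_on_cong)
next
  case (Suc k)
  have "g differentiable (at x)" if "x \<in> S" for x
  proof -
    have "f differentiable (at x)" using Suc.prems that by simp
    then show ?thesis
      unfolding differentiable_def
      using has_derivative_transform_within_open[of f _ x UNIV S g, OF _ assms(1) that Suc.prems(1)]
      by metis
  qed
  moreover have "k_smooth_on k S (\<lambda>x. frechet_derivative g (at x) v)" for v
  proof (rule Suc.IH)
    show "k_smooth_on k S (\<lambda>x. frechet_derivative f (at x) v)"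
      using Suc.prems(2) by simp
    show "frechet_derivative f (at y) v = frechet_derivative g (at y) v" if "y \<in> S" for y
      using frechet_derivative_cong_open[OF assms(1) that Suc.prems(1)] by simp
  qed
  ultimately show ?case by simp
qed

lemma k_smooth_on_inner:
  fixes f :: "'a::real_normed_vector \<Rightarrow> 'b::euclidean_space"
  assumes "open S" "k_smooth_on k S f"
  shows "k_smooth_on k S (\<lambda>y. f y \<bullet> i)"
  using assms(2)
proof (induction k arbitrary: f)
  case 0
  then show ?case by (auto intro: continuous_intros)
next
  case (Suc k)
  have d: "f differentiable (at x)" if "x \<in> S" for x using Suc.prems that by simp
  have "(\<lambda>y. f y \<bullet> i) differentiable (at x)" if "x \<in> S" for x
    using has_derivative_inner_left[OF has_derivative_frechet[OF d[OF that]]]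
    unfolding differentiable_def by blast
  moreover have "k_smooth_on k S (\<lambda>x. frechet_derivative (\<lambda>y. f y \<bullet> i) (at x) v)" for v
  proof (rule k_smooth_on_cong[OF assms(1)])
    show "k_smooth_on k S (\<lambda>x. frechet_derivative f (at x) v \<bullet> i)"
      using Suc.prems by (intro Suc.IH) simp
    show "frechet_derivative f (at y) v \<bullet> i = frechet_derivative (\<lambda>y. f y \<bullet> i) (at y) v"
      if "y \<in> S" for y
      by (simp add: frechet_derivative_inner[OF d[OF that]])
  qed
  ultimately show ?case by simp
qed

lemma second_derivative_symmetric:
  fixes f :: "'a::real_normed_vector \<Rightarrow> 'b::euclidean_space"
  assumes S: "open S" "x \<in> S" and f: "smooth_on S f"
  shows "frechet_derivative (\<lambda>z. frechet_derivative f (at z) u) (at x) w =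
         frechet_derivative (\<lambda>z. frechet_derivative f (at z) w) (at x) u"
proof (rule euclidean_eqI)
  fix i :: 'b assume "i \<in> Basis"
  have comp: "frechet_derivative (\<lambda>z. frechet_derivative (\<lambda>y. f y \<bullet> i) (at z) u) (at x) w =
      frechet_derivative (\<lambda>z. frechet_derivative f (at z) u) (at x) w \<bullet> i" for u w
  proof -
    have "frechet_derivative (\<lambda>z. frechet_derivative (\<lambda>y. f y \<bullet> i) (at z) u) (at x) =
        frechet_derivative (\<lambda>z. frechet_derivative f (at z) u \<bullet> i) (at x)"
      by (rule frechet_derivative_cong_open[OF S])
        (simp add: frechet_derivative_inner[OF smooth_on_differentiable[OF f]])
    also have "\<dots> = (\<lambda>w. frechet_derivative (\<lambda>z. frechet_derivative f (at z) u) (at x) w \<bullet> i)"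
      by (intro frechet_derivative_inner smooth_on_differentiable[OF smooth_on_deriv[OF f]] S)
    finally show ?thesis by simp
  qed
  have "smooth_on S (\<lambda>y. f y \<bullet> i)"
    using f k_smooth_on_inner[OF S(1)] by (auto simp: smooth_on_def)
  from second_derivative_symmetric_real[OF S this] show
    "frechet_derivative (\<lambda>z. frechet_derivative f (at z) u) (at x) w \<bullet> i =
     frechet_derivative (\<lambda>z. frechet_derivative f (at z) w) (at x) u \<bullet> i"
    by (simp only: comp)
qed

lemma bilinear_expand:
  fixes F :: "'e::euclidean_space \<Rightarrow> 'e \<Rightarrow> real"
  assumes "bilinear F"
  shows "F a b = (\<Sum>i\<in>Basis. \<Sum>j\<in>Basis. (a \<bullet> i) * ((b \<bullet> j) * F i j))"
proof -
  have l: "linear (\<lambda>a. F a b)" "\<And>a. linear (F a)" for b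
    using assms by (auto simp: bilinear_def)
  have "F a b = F (\<Sum>i\<in>Basis. (a \<bullet> i) *\<^sub>R i) (\<Sum>j\<in>Basis. (b \<bullet> j) *\<^sub>R j)"
    by (simp add: euclidean_representation)
  also have "\<dots> = (\<Sum>i\<in>Basis. (a \<bullet> i) * F i (\<Sum>j\<in>Basis. (b \<bullet> j) *\<^sub>R j))"
    by (simp add: linear_sum[OF l(1)] linear_scale[OF l(1)])
  also have "\<dots> = (\<Sum>i\<in>Basis. (a \<bullet> i) * (\<Sum>j\<in>Basis. (b \<bullet> j) * F i j))"
    by (simp only: linear_sum[OF l(2)] linear_scale[OF l(2)] real_scaleR_def)
  finally show ?thesis by (simp add: sum_distrib_left)
qed

lemma bilinear_family_derivative:
  fixes F :: "'e::euclidean_space \<Rightarrow> 'e \<Rightarrow> 'e \<Rightarrow> real" and \<tau> :: "'e \<Rightarrow> 'e"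
  assumes W: "open W" "x0 \<in> W"
    and bil: "\<And>x. x \<in> W \<Longrightarrow> bilinear (F (\<tau> x))"
    and F: "\<And>a b. ((\<lambda>y. F y a b) has_derivative F' a b) (at (\<tau> x0))"
    and V: "open V" "\<tau> x0 \<in> V" "\<And>y. y \<in> V \<Longrightarrow> bilinear (F y)"
    and \<tau>: "(\<tau> has_derivative \<tau>') (at x0)"
    and G: "(G has_derivative G') (at x0)"
    and H: "(H has_derivative H') (at x0)"
  shows "((\<lambda>x. F (\<tau> x) (G x) (H x)) has_derivative
     (\<lambda>e. F' (G x0) (H x0) (\<tau>' e) + F (\<tau> x0) (G' e) (H x0) + F (\<tau> x0) (G x0) (H' e))) (at x0)"
proof -
  define E where "E = (\<lambda>x. \<Sum>i\<in>Basis. \<Sum>j\<in>Basis. (G x \<bullet> i) * ((H x \<bullet> j) * F (\<tau> x) i j))"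
  define E' where "E' = (\<lambda>e. \<Sum>i\<in>Basis. \<Sum>j\<in>Basis.
      (G x0 \<bullet> i) * ((H x0 \<bullet> j) * F' i j (\<tau>' e) + (H' e \<bullet> j) * F (\<tau> x0) i j) +
      (G' e \<bullet> i) * ((H x0 \<bullet> j) * F (\<tau> x0) i j))"
  have Ft: "((\<lambda>x. F (\<tau> x) i j) has_derivative (\<lambda>e. F' i j (\<tau>' e))) (at x0)" for i j
    by (rule has_derivative_compose[where g = "\<lambda>y. F y i j" and f = \<tau>, OF \<tau> F[of i j]])
  have E: "(E has_derivative E') (at x0)"
    unfolding E_def E'_def
    by (intro has_derivative_sum has_derivative_mult Ft has_derivative_inner_left G H)
  have EF: "E x = F (\<tau> x) (G x) (H x)" if "x \<in> W" for x
    unfolding E_def by (rule bilinear_expand[OF bil[OF that], of "G x" "H x", symmetric])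
  have F'eq: "F' a b = (\<lambda>z. \<Sum>i\<in>Basis. \<Sum>j\<in>Basis. (a \<bullet> i) * ((b \<bullet> j) * F' i j z))" for a b
  proof -
    define K where "K = (\<lambda>y. \<Sum>i\<in>Basis. \<Sum>j\<in>Basis. (a \<bullet> i) * ((b \<bullet> j) * F y i j))"
    define K' where "K' = (\<lambda>z. \<Sum>i\<in>Basis. \<Sum>j\<in>Basis. (a \<bullet> i) * ((b \<bullet> j) * F' i j z))"
    have K: "(K has_derivative K') (at (\<tau> x0))"
      unfolding K_def K'_def by (intro has_derivative_sum has_derivative_mult_right F)
    have eq: "K y = F y a b" if "y \<in> V" for y
      unfolding K_def by (rule bilinear_expand[OF V(3)[OF that], of a b, symmetric])
    have "((\<lambda>y. F y a b) has_derivative K') (at (\<tau> x0))"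
      by (rule has_derivative_transform_within_open[OF K V(1,2) eq])
    from has_derivative_unique[OF F[of a b] this] show ?thesis
      unfolding K'_def .
  qed
  have "((\<lambda>x. F (\<tau> x) (G x) (H x)) has_derivative E') (at x0)"
    by (rule has_derivative_transform_within_open[OF E W EF])
  moreover have "E' = (\<lambda>e. F' (G x0) (H x0) (\<tau>' e) + F (\<tau> x0) (G' e) (H x0) +
      F (\<tau> x0) (G x0) (H' e))"
  proof
    fix e
    have "F' (G x0) (H x0) (\<tau>' e) =
        (\<Sum>i\<in>Basis. \<Sum>j\<in>Basis. (G x0 \<bullet> i) * ((H x0 \<bullet> j) * F' i j (\<tau>' e)))"
      by (subst F'eq) simp
    moreover have "F (\<tau> x0) (G' e) (H x0) =
        (\<Sum>i\<in>Basis. \<Sum>j\<in>Basis. (G' e \<bullet> i) * ((H x0 \<bullet> j) * F (\<tau> x0) i j))"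
      by (rule bilinear_expand[OF bil[OF W(2)], of "G' e" "H x0"])
    moreover have "F (\<tau> x0) (G x0) (H' e) =
        (\<Sum>i\<in>Basis. \<Sum>j\<in>Basis. (G x0 \<bullet> i) * ((H' e \<bullet> j) * F (\<tau> x0) i j))"
      by (rule bilinear_expand[OF bil[OF W(2)], of "G x0" "H' e"])
    ultimately show "E' e = F' (G x0) (H x0) (\<tau>' e) + F (\<tau> x0) (G' e) (H x0) +
        F (\<tau> x0) (G x0) (H' e)"
      unfolding E'_def by (simp only: sum.distrib distrib_left ac_simps)
  qed
  ultimately show ?thesis by simp
qed


context
  fixes X :: "'m topology" and A :: "('m, 'e::euclidean_space) chart set"
  assumes X: "smooth_manifold X A"
begin

lemma chart_inv_right:
  assumes "c \<in> A" "p \<in> fst c" shows "chart_inv c (snd c p) = p"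
proof -
  have "openin X (fst c)"
    and "homeomorphic_map (subtopology X (fst c)) (top_of_set (snd c ` fst c)) (snd c)"
    using X assms(1) unfolding smooth_manifold_def by blast+
  then have "inj_on (snd c) (fst c)"
    using homeomorphic_imp_injective_map openin_subset
    by (metis inf.absorb_iff2 topspace_subtopology)
  then show ?thesis
    unfolding chart_inv_def using assms(2) by (rule inv_into_f_f)
qed

lemma transition_at:
  assumes "c \<in> A" "p \<in> fst c" shows "transition c c' (snd c p) = snd c' p"
  using chart_inv_right[OF assms] by (simp add: transition_def)

lemma open_overlap:
  assumes c: "c \<in> A" and V: "openin X V" "V \<subseteq> fst c"
  shows "open (snd c ` V)"
proof -
  have h: "homeomorphic_map (subtopology X (fst c)) (top_of_set (snd c ` fst c)) (snd c)"
    and o: "open (snd c ` fst c)"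
    using X c unfolding smooth_manifold_def by blast+
  have "openin (subtopology X (fst c)) V"
    using V openin_subtopology_Int[OF V(1), of "fst c"] by (simp add: inf.absorb1)
  then have "openin (top_of_set (snd c ` fst c)) (snd c ` V)"
    using homeomorphic_imp_open_map[OF h] unfolding open_map_def by blast
  then show ?thesis
    using o openin_open_trans by blast
qed

lemma chart_openin: "c \<in> A \<Longrightarrow> openin X (fst c)"
  using X unfolding smooth_manifold_def by blast

lemma transition_smooth:
  "c \<in> A \<Longrightarrow> c' \<in> A \<Longrightarrow> smooth_on (snd c ` (fst c \<inter> fst c')) (transition c c')"
  using X unfolding smooth_manifold_def by blast

lemma transition_has_derivative:
  assumes "c \<in> A" "c' \<in> A" "p \<in> fst c" "p \<in> fst c'"
  shows "(transition c c' has_derivative frechet_derivative (transition c c') (at (snd c p)))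
           (at (snd c p))"
  by (intro has_derivative_frechet smooth_on_differentiable[OF transition_smooth[OF assms(1,2)]]
      imageI) (use assms in auto)

lemma transition_cocycle:
  assumes c: "c \<in> A" "c' \<in> A" "c'' \<in> A" and p: "p \<in> fst c" "p \<in> fst c'" "p \<in> fst c''"
  shows "frechet_derivative (transition c c'') (at (snd c p)) a =
    frechet_derivative (transition c' c'') (at (snd c' p))
      (frechet_derivative (transition c c') (at (snd c p)) a)"
proof -
  let ?V = "fst c \<inter> fst c' \<inter> fst c''"
  let ?D = "frechet_derivative (transition c c') (at (snd c p))"
  let ?D' = "frechet_derivative (transition c' c'') (at (snd c' p))"
  have "openin X ?V"
    using c by (intro openin_Int chart_openin)
  then have o: "open (snd c ` ?V)"
    by (rule open_overlap[OF c(1)]) blast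
  have D': "(transition c' c'' has_derivative ?D') (at (transition c c' (snd c p)))"
    using transition_has_derivative[OF c(2,3) p(2,3)] by (simp add: transition_at[OF c(1) p(1)])
  have comp: "((\<lambda>x. transition c' c'' (transition c c' x)) has_derivative (\<lambda>a. ?D' (?D a)))
     (at (snd c p))"
    by (rule has_derivative_compose[OF transition_has_derivative[OF c(1,2) p(1,2)] D'])
  have eq: "transition c' c'' (transition c c' x) = transition c c'' x"
    if "x \<in> snd c ` ?V" for x
    using that c by (auto simp: transition_at)
  have "snd c p \<in> snd c ` ?V" using p by blast
  then have "(transition c c'' has_derivative (\<lambda>a. ?D' (?D a))) (at (snd c p))"
    by (rule has_derivative_transform_within_open[OF comp o]) (rule eq)
  from frechet_derivative_at[OF this, symmetric] show ?thesis by simp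
qed

lemma tvec_of_change:
  assumes "c \<in> charts_at A p" "c' \<in> charts_at A p"
  shows "tvec_of A c p a = tvec_of A c' p (frechet_derivative (transition c c') (at (snd c p)) a)"
proof
  fix c''
  show "tvec_of A c p a c'' =
      tvec_of A c' p (frechet_derivative (transition c c') (at (snd c p)) a) c''"
  proof (cases "c'' \<in> charts_at A p")
    case True
    then have "frechet_derivative (transition c c'') (at (snd c p)) a =
      frechet_derivative (transition c' c'') (at (snd c' p))
        (frechet_derivative (transition c c') (at (snd c p)) a)"
      using assms by (intro transition_cocycle) (simp_all add: charts_at_def)
    with True show ?thesis by (simp only: tvec_of_def if_True)
  qed (simp add: tvec_of_def)
qed

lemma tvec_of_tangent:
  assumes "c \<in> charts_at A p" shows "tvec_of A c p a \<in> tangent_space A p"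
proof -
  have "tvec_of A c p a c'' = frechet_derivative (transition c' c'') (at (snd c' p)) (tvec_of A c p a c')"
    if "c' \<in> charts_at A p" "c'' \<in> charts_at A p" for c' c''
  proof -
    have "frechet_derivative (transition c c'') (at (snd c p)) a =
      frechet_derivative (transition c' c'') (at (snd c' p))
        (frechet_derivative (transition c c') (at (snd c p)) a)"
      using assms that by (intro transition_cocycle) (simp_all add: charts_at_def)
    with that show ?thesis by (simp only: tvec_of_def if_True)
  qed
  moreover have "tvec_of A c p a c' = 0" if "c' \<notin> charts_at A p" for c'
    using that by (simp add: tvec_of_def)
  ultimately show ?thesis
    unfolding tangent_space_def by blast
qed

lemma tvec_of_comb:
  assumes "c \<in> charts_at A p"
  shows "tvec_of A c p (s *\<^sub>R a + t *\<^sub>R b) = tcomb s (tvec_of A c p a) t (tvec_of A c p b)"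
proof
  fix c'
  show "tvec_of A c p (s *\<^sub>R a + t *\<^sub>R b) c' = tcomb s (tvec_of A c p a) t (tvec_of A c p b) c'"
  proof (cases "c' \<in> charts_at A p")
    case True
    then have "linear (frechet_derivative (transition c c') (at (snd c p)))"
      using assms transition_has_derivative[of c c' p] has_derivative_linear
      by (auto simp: charts_at_def)
    then show ?thesis
      using True by (simp add: tvec_of_def tcomb_def linear_add linear_scale)
  qed (simp add: tvec_of_def tcomb_def)
qed

lemma local_tensor_bilinear:
  assumes g: "smooth_tensor2 A g" and c: "c \<in> A" and x: "x \<in> snd c ` fst c"
  shows "bilinear (local_tensor A g c x)"
proof -
  define p where "p = chart_inv c x"
  have cp: "c \<in> charts_at A p"
    using c x chart_inv_right[OF c] by (auto simp: p_def charts_at_def)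
  then have p: "p \<in> points A" by (auto simp: charts_at_def points_def)
  have lt: "local_tensor A g c x a b = g p (tvec_of A c p a) (tvec_of A c p b)" for a b
    by (simp add: local_tensor_def p_def)
  have g': "g p (tcomb s u t v) w = s * g p u w + t * g p v w"
    "g p w (tcomb s u t v) = s * g p w u + t * g p w v"
    if "u \<in> tangent_space A p" "v \<in> tangent_space A p" "w \<in> tangent_space A p" for s u t v w
    using g p that unfolding smooth_tensor2_def by blast+
  have comb: "local_tensor A g c x (s *\<^sub>R a + t *\<^sub>R b) e =
      s * local_tensor A g c x a e + t * local_tensor A g c x b e"
    "local_tensor A g c x e (s *\<^sub>R a + t *\<^sub>R b) =
      s * local_tensor A g c x e a + t * local_tensor A g c x e b" for s a t b e
    unfolding lt tvec_of_comb[OF cp] by (intro g' tvec_of_tangent[OF cp])+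
  show ?thesis
    unfolding bilinear_def
  proof (intro conjI allI linearI)
    fix a b e :: 'e and s :: real
    show "local_tensor A g c x e (a + b) = local_tensor A g c x e a + local_tensor A g c x e b"
      using comb(2)[of e 1 a 1 b] by simp
    show "local_tensor A g c x (a + b) e = local_tensor A g c x a e + local_tensor A g c x b e"
      using comb(1)[of 1 a 1 b e] by simp
    show "local_tensor A g c x e (s *\<^sub>R a) = s *\<^sub>R local_tensor A g c x e a"
      using comb(2)[of e s a 0 a] by simp
    show "local_tensor A g c x (s *\<^sub>R a) e = s *\<^sub>R local_tensor A g c x a e"
      using comb(1)[of s a 0 a e] by simp
  qed
qed

theorem ext_deriv_in_unique:
  assumes \<omega>: "\<omega> \<in> Omega2 A" and c: "c \<in> charts_at A p" and c': "c' \<in> charts_at A p"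
    and u: "u \<in> tangent_space A p" and v: "v \<in> tangent_space A p" and w: "w \<in> tangent_space A p"
  shows "ext_deriv_in A c \<omega> p u v w = ext_deriv_in A c' \<omega> p u v w"
proof -
  have cA: "c \<in> A" "p \<in> fst c" and cA': "c' \<in> A" "p \<in> fst c'"
    using c c' by (auto simp: charts_at_def)
  have sm: "smooth_tensor2 A \<omega>" using \<omega> by (simp add: Omega2_def)
  define x0 where "x0 = snd c p"
  define W where "W = snd c ` (fst c \<inter> fst c')"
  define V where "V = snd c' ` fst c'"
  define \<tau> where "\<tau> = transition c c'"
  define P where "P = (\<lambda>x a. frechet_derivative \<tau> (at x) a)"
  define Q where "Q = (\<lambda>a b. frechet_derivative (\<lambda>x. P x b) (at x0) a)"
  define F where "F = local_tensor A \<omega> c'"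
  define F' where "F' = (\<lambda>a b z. frechet_derivative (\<lambda>y. F y a b) (at (\<tau> x0)) z)"
  have W: "open W" "x0 \<in> W"
    unfolding W_def x0_def using cA cA'
    by (auto intro!: open_overlap openin_Int chart_openin)
  have V: "open V"
    unfolding V_def by (rule open_overlap[OF cA'(1) chart_openin[OF cA'(1)]]) simp
  have \<tau>V: "\<tau> x \<in> V" if "x \<in> W" for x
    using that cA(1) by (auto simp: \<tau>_def W_def V_def transition_at)
  have bilV: "bilinear (F y)" if "y \<in> V" for y
    using that unfolding F_def V_def by (rule local_tensor_bilinear[OF sm cA'(1)])
  have \<tau>s: "smooth_on W \<tau>"
    unfolding W_def \<tau>_def by (rule transition_smooth[OF cA(1) cA'(1)])
  have \<tau>d: "(\<tau> has_derivative P x0) (at x0)"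
    unfolding P_def using has_derivative_frechet[OF smooth_on_differentiable[OF \<tau>s W(2)]] .
  have Pd: "((\<lambda>x. P x b) has_derivative (\<lambda>a. Q a b)) (at x0)" for b
    unfolding P_def Q_def
    using has_derivative_frechet[OF smooth_on_differentiable[OF smooth_on_deriv[OF \<tau>s] W(2)]] .
  have Qsym: "Q a b = Q b a" for a b
    unfolding P_def Q_def by (rule second_derivative_symmetric[OF W \<tau>s])
  have "smooth_on V (\<lambda>y. F y a b)" for a b
    using sm cA'(1) unfolding smooth_tensor2_def F_def V_def by blast
  then have Fd: "((\<lambda>y. F y a b) has_derivative F' a b) (at (\<tau> x0))" for a b
    unfolding F'_def by (intro has_derivative_frechet smooth_on_differentiable[OF _ \<tau>V[OF W(2)]])
  have change: "local_tensor A \<omega> c x a b = F (\<tau> x) (P x a) (P x b)" if x: "x \<in> W" for x a b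
  proof -
    obtain q where q: "q \<in> fst c" "q \<in> fst c'" "x = snd c q"
      using x by (auto simp: W_def)
    have cq: "c \<in> charts_at A q" "c' \<in> charts_at A q"
      using q cA cA' by (auto simp: charts_at_def)
    show ?thesis
      using chart_inv_right[OF cA(1) q(1)] chart_inv_right[OF cA'(1) q(2)]
        transition_at[OF cA(1) q(1), of c'] tvec_of_change[OF cq]
      by (simp add: local_tensor_def F_def \<tau>_def P_def q(3))
  qed
  have D: "frechet_derivative (\<lambda>x. local_tensor A \<omega> c x b e) (at x0) a =
      F' (P x0 b) (P x0 e) (P x0 a) + F (\<tau> x0) (Q a b) (P x0 e) + F (\<tau> x0) (P x0 b) (Q a e)"
    for a b e
  proof -
    have "((\<lambda>x. F (\<tau> x) (P x b) (P x e)) has_derivative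
      (\<lambda>a. F' (P x0 b) (P x0 e) (P x0 a) + F (\<tau> x0) (Q a b) (P x0 e) +
        F (\<tau> x0) (P x0 b) (Q a e))) (at x0)"
      by (rule bilinear_family_derivative[OF W bilV[OF \<tau>V] Fd V \<tau>V[OF W(2)] bilV \<tau>d Pd Pd])
    then have "((\<lambda>x. local_tensor A \<omega> c x b e) has_derivative
      (\<lambda>a. F' (P x0 b) (P x0 e) (P x0 a) + F (\<tau> x0) (Q a b) (P x0 e) +
        F (\<tau> x0) (P x0 b) (Q a e))) (at x0)"
      by (rule has_derivative_transform_within_open[OF _ W]) (simp add: change)
    from frechet_derivative_at[OF this, symmetric] show ?thesis by simp
  qed
  have \<tau>p: "\<tau> x0 = snd c' p"
    unfolding \<tau>_def x0_def by (rule transition_at[OF cA])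
  have anti: "F (\<tau> x0) a b = - F (\<tau> x0) b a" for a b
  proof -
    have pA: "p \<in> points A" using cA by (auto simp: points_def)
    show ?thesis
      using \<omega> pA tvec_of_tangent[OF c']
      unfolding F_def local_tensor_def \<tau>p chart_inv_right[OF cA'] Omega2_def by blast
  qed
  have P: "P x0 (z c) = z c'" if "z \<in> tangent_space A p" for z
  proof -
    have "z c' = frechet_derivative (transition c c') (at (snd c p)) (z c)"
      using that c c' unfolding tangent_space_def by blast
    then show ?thesis
      by (simp only: P_def \<tau>_def x0_def)
  qed
  have "ext_deriv_in A c \<omega> p u v w =
     F' (v c') (w c') (u c') - F' (u c') (w c') (v c') + F' (u c') (v c') (w c')"
    unfolding ext_deriv_in_def Let_def x0_def[symmetric] D P[OF u] P[OF v] P[OF w]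
    using Qsym[of "v c" "u c"] Qsym[of "w c" "u c"] Qsym[of "w c" "v c"]
      anti[of "v c'" "Q (u c) (w c)"] anti[of "u c'" "Q (v c) (w c)"]
      anti[of "u c'" "Q (w c) (v c)"]
    by simp
  also have "\<dots> = ext_deriv_in A c' \<omega> p u v w"
    unfolding ext_deriv_in_def Let_def F'_def \<tau>p F_def by simp
  finally show ?thesis .
qed

theorem ext_deriv_eq:
  assumes "\<omega> \<in> Omega2 A" "c \<in> charts_at A p"
    and "u \<in> tangent_space A p" "v \<in> tangent_space A p" "w \<in> tangent_space A p"
  shows "ext_deriv A \<omega> p u v w = ext_deriv_in A c \<omega> p u v w"
proof -
  have p: "p \<in> points A" using assms(2) by (auto simp: charts_at_def points_def)
  have "(SOME c. c \<in> charts_at A p) \<in> charts_at A p"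
    using assms(2) by (rule someI)
  from ext_deriv_in_unique[OF assms(1) this assms(2-5)] show ?thesis
    using p assms(3-5) by (simp only: ext_deriv_def simp_thms if_True)
qed

end

end

theory Submission
  imports Defs
begin

text \<open>
  Write \<open>d\<close> for the exterior derivative. The equivalences rest on two facts.

  \<^item> A symplectic form taming \<open>J\<close> exists iff \<open>d \<Omega>\<^sup>-\<close> meets \<open>d \<Omega>\<^sup>\<oplus>\<close>: the anti-invariant part of a
    form vanishes on the pairs \<open>(u, J u)\<close>, so the invariant part of a taming form is positive, and
    closedness says that its derivative is the derivative of minus the anti-invariant part.
    Conversely, if \<open>d \<sigma> = d \<alpha>\<close> with \<open>\<sigma>\<close> in \<open>\<Omega>\<^sup>\<oplus>\<close> and \<open>\<alpha>\<close> in \<open>\<Omega>\<^sup>-\<close>, then \<open>\<sigma> - \<alpha>\<close>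
    tames \<open>J\<close>. This is \<open>ex_tames_iff\<close>.

  \<^item> A compatible form exists iff \<open>0 \<in> d \<Omega>\<^sup>\<oplus>\<close>, and on a compact manifold this is the case iff
    \<open>d \<Omega>\<^sup>\<oplus> = d \<Omega>\<^sup>+\<close>: if \<open>\<omega>\<close> is closed and positive and \<open>\<alpha>\<close> is invariant, then \<open>\<alpha> + K \<omega>\<close> is
    positive for large \<open>K\<close> and has the same derivative as \<open>\<alpha>\<close>. These are \<open>ex_compatible_iff\<close> and
    \<open>zero_in_d_oplus_iff\<close>, and the constant \<open>K\<close> comes from \<open>exists_dominating_multiple\<close>.

  So (a) and (b) are the same condition. Since \<open>\<Omega>\<^sup>+\<close> is a vector space, (b) implies
  (c). Conversely, \<open>\<Omega>\<^sup>\<oplus>\<close> is a convex cone, so that \<open>d \<alpha>\<close> and \<open>- d \<alpha>\<close> can both lie in \<open>d \<Omega>\<^sup>\<oplus>\<close> only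
  if \<open>0\<close> does.

  Beyond compactness, the analytic input is that the invariant part of a smooth form is smooth,
  which is read off in a chart, where the matrix entries of \<open>J\<close> and of the form are smooth
  functions.
\<close>

section \<open>Algebra of smooth functions\<close>

lemma k_smooth_on_SucD: "k_smooth_on (Suc k) S f \<Longrightarrow> k_smooth_on k S f"
proof (induction k arbitrary: f)
  case 0
  then show ?case
    by (auto intro!: differentiable_imp_continuous_on differentiable_at_imp_differentiable_on)
qed simp

lemma k_smooth_on_const: "k_smooth_on k S (\<lambda>x. c)"
  by (induction k arbitrary: c) auto

lemma k_smooth_on_add:
  assumes S: "open S" and f: "k_smooth_on k S f" and g: "k_smooth_on k S g"
  shows "k_smooth_on k S (\<lambda>x. f x + g x)"
  using f g
proof (induction k arbitrary: f g)
  case 0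
  then show ?case by (auto intro: continuous_on_add)
next
  case (Suc k)
  have d: "f differentiable (at x)" "g differentiable (at x)" if "x \<in> S" for x
    using Suc.prems that by auto
  have "k_smooth_on k S (\<lambda>x. frechet_derivative (\<lambda>x. f x + g x) (at x) v)" for v
  proof (rule k_smooth_on_cong[OF S])
    show "k_smooth_on k S (\<lambda>x. frechet_derivative f (at x) v + frechet_derivative g (at x) v)"
      using Suc.prems by (intro Suc.IH) auto
    show "frechet_derivative f (at x) v + frechet_derivative g (at x) v =
        frechet_derivative (\<lambda>x. f x + g x) (at x) v" if "x \<in> S" for x
      by (rule fun_cong[OF frechet_derivative_at[OF has_derivative_add[OF
            has_derivative_frechet[OF d(1)[OF that]] has_derivative_frechet[OF d(2)[OF that]]]]])
  qed
  then show ?case using d by (auto intro: differentiable_add)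
qed

lemma k_smooth_on_mult:
  fixes f g :: "'a::real_normed_vector \<Rightarrow> real"
  assumes S: "open S" and f: "k_smooth_on k S f" and g: "k_smooth_on k S g"
  shows "k_smooth_on k S (\<lambda>x. f x * g x)"
  using f g
proof (induction k arbitrary: f g)
  case 0
  then show ?case by (auto intro: continuous_on_mult)
next
  case (Suc k)
  have d: "f differentiable (at x)" "g differentiable (at x)" if "x \<in> S" for x
    using Suc.prems that by auto
  have "k_smooth_on k S (\<lambda>x. frechet_derivative (\<lambda>x. f x * g x) (at x) v)" for v
  proof (rule k_smooth_on_cong[OF S])
    show "k_smooth_on k S
        (\<lambda>x. f x * frechet_derivative g (at x) v + frechet_derivative f (at x) v * g x)"
      using Suc.prems Suc.prems[THEN k_smooth_on_SucD]
      by (intro k_smooth_on_add[OF S] Suc.IH) simp_all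
    show "f x * frechet_derivative g (at x) v + frechet_derivative f (at x) v * g x =
        frechet_derivative (\<lambda>x. f x * g x) (at x) v" if "x \<in> S" for x
      by (rule fun_cong[OF frechet_derivative_at[OF has_derivative_mult[OF
            has_derivative_frechet[OF d(1)[OF that]] has_derivative_frechet[OF d(2)[OF that]]]]])
  qed
  then show ?case using d by (auto intro: differentiable_mult)
qed

lemma smooth_on_const: "smooth_on S (\<lambda>x. c)"
  by (simp add: smooth_on_def k_smooth_on_const)

lemma smooth_on_add:
  "open S \<Longrightarrow> smooth_on S f \<Longrightarrow> smooth_on S g \<Longrightarrow> smooth_on S (\<lambda>x. f x + g x)"
  by (simp add: smooth_on_def k_smooth_on_add)

lemma smooth_on_mult:
  fixes f g :: "'a::real_normed_vector \<Rightarrow> real"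
  shows "open S \<Longrightarrow> smooth_on S f \<Longrightarrow> smooth_on S g \<Longrightarrow> smooth_on S (\<lambda>x. f x * g x)"
  by (simp add: smooth_on_def k_smooth_on_mult)

lemma smooth_on_sum:
  assumes "open S" "finite I" "\<And>i. i \<in> I \<Longrightarrow> smooth_on S (f i)"
  shows "smooth_on S (\<lambda>x. \<Sum>i\<in>I. f i x)"
  using assms(2,3)
  by (induction I rule: finite_induct) (auto intro: smooth_on_const smooth_on_add[OF assms(1)])

lemma smooth_on_inner:
  fixes f :: "'a::real_normed_vector \<Rightarrow> 'b::euclidean_space"
  shows "open S \<Longrightarrow> smooth_on S f \<Longrightarrow> smooth_on S (\<lambda>x. f x \<bullet> i)"
  by (simp add: smooth_on_def k_smooth_on_inner)

lemma smooth_on_cong: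
  assumes "open S" "smooth_on S f" "\<And>x. x \<in> S \<Longrightarrow> f x = g x"
  shows "smooth_on S g"
  using assms k_smooth_on_cong[of S f g] by (simp add: smooth_on_def)


section \<open>Smooth 2-tensors and linear combinations of forms\<close>

definition tensor_comb ::
    "real \<Rightarrow> ('m, 'e::euclidean_space) tensor2 \<Rightarrow> real \<Rightarrow> ('m, 'e) tensor2 \<Rightarrow> ('m, 'e) tensor2" where
  "tensor_comb a g b h = (\<lambda>p u v. a * g p u v + b * h p u v)"

lemma J_invariant_comb:
  "J_invariant A J g \<Longrightarrow> J_invariant A J h \<Longrightarrow> J_invariant A J (tensor_comb a g b h)"
  by (simp add: J_invariant_def tensor_comb_def)

lemma smooth_tensor2_bilinear:
  assumes "smooth_tensor2 A g" "p \<in> points A"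
    and "u \<in> tangent_space A p" "v \<in> tangent_space A p" "w \<in> tangent_space A p"
  shows "g p (tcomb a u b v) w = a * g p u w + b * g p v w"
    and "g p w (tcomb a u b v) = a * g p w u + b * g p w v"
  using assms unfolding smooth_tensor2_def by blast+

lemma smooth_tensor2_minus:
  assumes "smooth_tensor2 A g" "p \<in> points A" "u \<in> tangent_space A p" "w \<in> tangent_space A p"
  shows "g p (\<lambda>c. - u c) w = - g p u w" and "g p w (\<lambda>c. - u c) = - g p w u"
proof -
  have "(\<lambda>c. - u c) = tcomb (-1) u 0 u" by (simp add: tcomb_def)
  then show "g p (\<lambda>c. - u c) w = - g p u w" "g p w (\<lambda>c. - u c) = - g p w u"
    using smooth_tensor2_bilinear[OF assms(1-3,3,4), of "-1" 0] by simp_all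
qed

lemma smooth_tensor2_flip:
  assumes "smooth_tensor2 A g"
  shows "smooth_tensor2 A (\<lambda>p u v. g p v u)"
  unfolding smooth_tensor2_def
proof (intro conjI ballI allI)
  fix p u v w a b
  assume t: "p \<in> points A" "u \<in> tangent_space A p" "v \<in> tangent_space A p" "w \<in> tangent_space A p"
  show "g p w (tcomb a u b v) = a * g p w u + b * g p w v"
    "g p (tcomb a u b v) w = a * g p u w + b * g p v w"
    by (rule smooth_tensor2_bilinear[OF assms t])+
next
  fix c a b assume "c \<in> A"
  then show "smooth_on (snd c ` fst c) (\<lambda>x. local_tensor A (\<lambda>p u v. g p v u) c x a b)"
    using assms unfolding smooth_tensor2_def local_tensor_def by blast
qed

lemma smooth_tensor2_local:
  "smooth_tensor2 A g \<Longrightarrow> c \<in> A \<Longrightarrow> smooth_on (snd c ` fst c) (\<lambda>x. local_tensor A g c x a b)"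
  unfolding smooth_tensor2_def by blast

lemma Omega2_antisym:
  assumes "\<omega> \<in> Omega2 A" "p \<in> points A" "u \<in> tangent_space A p" "v \<in> tangent_space A p"
  shows "\<omega> p u v = - \<omega> p v u"
  using assms unfolding Omega2_def by blast

lemma Omega2_smooth: "\<omega> \<in> Omega2 A \<Longrightarrow> smooth_tensor2 A \<omega>"
  by (simp add: Omega2_def)

lemma Omega2_junk:
  "\<omega> \<in> Omega2 A \<Longrightarrow> \<not> (p \<in> points A \<and> u \<in> tangent_space A p \<and> v \<in> tangent_space A p) \<Longrightarrow>
    \<omega> p u v = 0"
  unfolding Omega2_def by blast

lemma tangent_eq_tvec_of:
  assumes "u \<in> tangent_space A p" "c \<in> charts_at A p"
  shows "tvec_of A c p (u c) = u"
proof
  fix c'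
  have "u c' = frechet_derivative (transition c c') (at (snd c p)) (u c)" if "c' \<in> charts_at A p"
    using assms that unfolding tangent_space_def by blast
  moreover have "u c' = 0" if "c' \<notin> charts_at A p"
    using assms(1) that unfolding tangent_space_def by blast
  ultimately show "tvec_of A c p (u c) c' = u c'"
    by (simp add: tvec_of_def)
qed

context
  fixes X :: "'m topology" and A :: "('m, 'e::euclidean_space) chart set"
  assumes X: "smooth_manifold X A"
begin

lemma open_chart_image: "c \<in> A \<Longrightarrow> open (snd c ` fst c)"
  using X unfolding smooth_manifold_def by blast

lemma points_eq_topspace: "points A = topspace X"
  using X unfolding smooth_manifold_def points_def by blast

lemma chart_inv_charts_at:
  assumes "c \<in> A" "x \<in> snd c ` fst c"
  shows "c \<in> charts_at A (chart_inv c x)" and "chart_inv c x \<in> points A"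
  using assms chart_inv_right[OF X assms(1)] by (auto simp: charts_at_def points_def)

lemma tcomb_tangent:
  assumes u: "u \<in> tangent_space A p" and v: "v \<in> tangent_space A p"
  shows "tcomb a u b v \<in> tangent_space A p"
proof -
  have "tcomb a u b v c' = frechet_derivative (transition c c') (at (snd c p)) (tcomb a u b v c)"
    if c: "c \<in> charts_at A p" "c' \<in> charts_at A p" for c c'
  proof -
    have "linear (frechet_derivative (transition c c') (at (snd c p)))"
      using c transition_has_derivative[OF X, of c c' p] has_derivative_linear
      by (auto simp: charts_at_def)
    moreover have "u c' = frechet_derivative (transition c c') (at (snd c p)) (u c)"
      "v c' = frechet_derivative (transition c c') (at (snd c p)) (v c)"
      using u v c unfolding tangent_space_def by blast+
    ultimately show ?thesis
      by (simp add: tcomb_def linear_add linear_scale)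
  qed
  moreover have "tcomb a u b v c = 0" if c: "c \<notin> charts_at A p" for c
  proof -
    have "u c = 0" "v c = 0" using u v c unfolding tangent_space_def by blast+
    then show ?thesis by (simp add: tcomb_def)
  qed
  ultimately show ?thesis unfolding tangent_space_def by blast
qed

text \<open>
  Values on pairs that are not tangent vectors are irrelevant for smoothness; this allows forms to
  be modified there to meet the normalisation in \<open>Omega2\<close>.
\<close>

lemma smooth_tensor2_cong:
  assumes g: "smooth_tensor2 A g"
    and eq: "\<And>p u v. p \<in> points A \<Longrightarrow> u \<in> tangent_space A p \<Longrightarrow> v \<in> tangent_space A p \<Longrightarrow>
      g p u v = h p u v"
  shows "smooth_tensor2 A h"
  unfolding smooth_tensor2_def
proof (intro conjI ballI allI)
  fix p u v w a b
  assume t: "p \<in> points A" "u \<in> tangent_space A p" "v \<in> tangent_space A p" "w \<in> tangent_space A p"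
  show "h p (tcomb a u b v) w = a * h p u w + b * h p v w"
    "h p w (tcomb a u b v) = a * h p w u + b * h p w v"
    using smooth_tensor2_bilinear[OF g t, of a b] t tcomb_tangent[OF t(2,3), of a b]
    by (simp_all add: eq)
next
  fix c a b assume c: "c \<in> A"
  show "smooth_on (snd c ` fst c) (\<lambda>x. local_tensor A h c x a b)"
  proof (rule smooth_on_cong[OF open_chart_image[OF c] smooth_tensor2_local[OF g c]])
    show "local_tensor A g c x a b = local_tensor A h c x a b" if "x \<in> snd c ` fst c" for x
      unfolding local_tensor_def
      by (intro eq tvec_of_tangent[OF X] chart_inv_charts_at[OF c that])
  qed
qed

lemma smooth_tensor2_comb:
  assumes g: "smooth_tensor2 A g" and h: "smooth_tensor2 A h"
  shows "smooth_tensor2 A (tensor_comb a g b h)"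
  unfolding smooth_tensor2_def
proof (intro conjI ballI allI)
  fix p u v w s t
  assume t: "p \<in> points A" "u \<in> tangent_space A p" "v \<in> tangent_space A p" "w \<in> tangent_space A p"
  show "tensor_comb a g b h p (tcomb s u t v) w =
      s * tensor_comb a g b h p u w + t * tensor_comb a g b h p v w"
    "tensor_comb a g b h p w (tcomb s u t v) =
      s * tensor_comb a g b h p w u + t * tensor_comb a g b h p w v"
    unfolding tensor_comb_def smooth_tensor2_bilinear[OF g t] smooth_tensor2_bilinear[OF h t]
    by (simp_all add: algebra_simps)
next
  fix c u v assume c: "c \<in> A"
  show "smooth_on (snd c ` fst c) (\<lambda>x. local_tensor A (tensor_comb a g b h) c x u v)"
    using smooth_tensor2_local[OF g c, of u v] smooth_tensor2_local[OF h c, of u v]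
    unfolding local_tensor_def tensor_comb_def
    by (intro smooth_on_add smooth_on_mult smooth_on_const open_chart_image[OF c])
qed

lemma Omega2_comb:
  assumes "\<omega> \<in> Omega2 A" "\<eta> \<in> Omega2 A"
  shows "tensor_comb a \<omega> b \<eta> \<in> Omega2 A"
proof -
  have "tensor_comb a \<omega> b \<eta> p u v = - tensor_comb a \<omega> b \<eta> p v u"
    if "p \<in> points A" "u \<in> tangent_space A p" "v \<in> tangent_space A p" for p u v
    using Omega2_antisym[OF assms(1) that] Omega2_antisym[OF assms(2) that]
    by (simp add: tensor_comb_def)
  moreover have "tensor_comb a \<omega> b \<eta> p u v = 0"
    if "\<not> (p \<in> points A \<and> u \<in> tangent_space A p \<and> v \<in> tangent_space A p)" for p u v
    using Omega2_junk[OF assms(1) that] Omega2_junk[OF assms(2) that] by (simp add: tensor_comb_def)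
  ultimately show ?thesis
    using smooth_tensor2_comb[OF assms[THEN Omega2_smooth]] unfolding Omega2_def by blast
qed

lemma ext_deriv_comb:
  assumes "\<omega> \<in> Omega2 A" "\<eta> \<in> Omega2 A"
  shows "ext_deriv A (tensor_comb a \<omega> b \<eta>) =
    (\<lambda>p u v w. a * ext_deriv A \<omega> p u v w + b * ext_deriv A \<eta> p u v w)"
proof (intro ext)
  fix p u v w
  show "ext_deriv A (tensor_comb a \<omega> b \<eta>) p u v w =
      a * ext_deriv A \<omega> p u v w + b * ext_deriv A \<eta> p u v w"
  proof (cases "p \<in> points A \<and> u \<in> tangent_space A p \<and> v \<in> tangent_space A p \<and> w \<in> tangent_space A p")
    case True
    define c where "c = (SOME c. c \<in> charts_at A p)"
    have "\<exists>c. c \<in> charts_at A p" using True by (auto simp: points_def charts_at_def)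
    then have "c \<in> charts_at A p" unfolding c_def by (rule someI_ex)
    then have c: "c \<in> A" "snd c p \<in> snd c ` fst c" by (auto simp: charts_at_def)
    have "frechet_derivative (\<lambda>x. local_tensor A (tensor_comb a \<omega> b \<eta>) c x y z) (at (snd c p)) e =
        a * frechet_derivative (\<lambda>x. local_tensor A \<omega> c x y z) (at (snd c p)) e +
        b * frechet_derivative (\<lambda>x. local_tensor A \<eta> c x y z) (at (snd c p)) e" for y z e
    proof -
      have d: "((\<lambda>x. local_tensor A \<theta> c x y z) has_derivative
          frechet_derivative (\<lambda>x. local_tensor A \<theta> c x y z) (at (snd c p))) (at (snd c p))"
        if "\<theta> \<in> Omega2 A" for \<theta>
        by (intro has_derivative_frechet smooth_on_differentiable[OF _ c(2)]
            smooth_tensor2_local Omega2_smooth that c(1))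
      have "local_tensor A (tensor_comb a \<omega> b \<eta>) c x y z =
          a * local_tensor A \<omega> c x y z + b * local_tensor A \<eta> c x y z" for x
        by (simp add: local_tensor_def tensor_comb_def)
      then show ?thesis
        using fun_cong[OF frechet_derivative_at[OF has_derivative_add[OF
            has_derivative_mult_right[OF d[OF assms(1)], of a]
            has_derivative_mult_right[OF d[OF assms(2)], of b]]], of e] by simp
    qed
    then show ?thesis
      using True by (simp add: ext_deriv_def c_def[symmetric] ext_deriv_in_def Let_def algebra_simps)
  qed (auto simp: ext_deriv_def)
qed

lemma ext_deriv_minus:
  assumes "\<alpha> \<in> Omega2 A"
  shows "ext_deriv A (\<lambda>p u v. - \<alpha> p u v) = (\<lambda>p u v w. - ext_deriv A \<alpha> p u v w)"
  using ext_deriv_comb[OF assms assms, of "-1" 0] by (simp add: tensor_comb_def)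


section \<open>A definite tensor on a compact manifold dominates every other tensor\<close>

text \<open>
  In a chart, the quotient of the two quadratic forms is continuous on the product of a closed ball
  of base points with the unit sphere of directions, hence bounded there; by homogeneity the bound
  holds in all directions.
\<close>

lemma local_domination:
  assumes g: "smooth_tensor2 A g" and h: "smooth_tensor2 A h"
    and pos: "\<And>p u. p \<in> points A \<Longrightarrow> u \<in> tangent_space A p \<Longrightarrow> u \<noteq> tzero \<Longrightarrow> g p u u > 0"
    and p: "p \<in> points A"
  shows "\<exists>N K. openin X N \<and> p \<in> N \<and> 0 \<le> K \<and>
    (\<forall>q\<in>N. \<forall>u\<in>tangent_space A q. \<bar>h q u u\<bar> \<le> K * g q u u)"
proof -
  obtain c where c: "c \<in> A" "p \<in> fst c" using p by (auto simp: points_def)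
  define V where "V = snd c ` fst c"
  define G where "G = local_tensor A g c"
  define H where "H = local_tensor A h c"
  have V: "open V" "snd c p \<in> V" using c open_chart_image by (auto simp: V_def)
  obtain r where r: "r > 0" "cball (snd c p) r \<subseteq> V" using V open_contains_cball by blast
  define T where "T = cball (snd c p) r \<times> sphere (0::'e) 1"
  have bil: "bilinear (G x)" "bilinear (H x)" if "x \<in> V" for x
    using local_tensor_bilinear[OF X] g h c(1) that by (auto simp: G_def H_def V_def)
  have cont: "continuous_on T (\<lambda>z. local_tensor A k c (fst z) (snd z) (snd z))"
    if k: "smooth_tensor2 A k" for k
  proof (rule continuous_on_eq)
    have "continuous_on T (\<lambda>z. local_tensor A k c (fst z) i j)" for i j
      by (rule continuous_on_compose2[OF smooth_on_continuous[OF smooth_tensor2_local[OF k c(1)]]])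
        (use r in \<open>auto simp: T_def V_def intro!: continuous_intros\<close>)
    then show "continuous_on T (\<lambda>z. \<Sum>i\<in>Basis. \<Sum>j\<in>Basis.
        (snd z \<bullet> i) * ((snd z \<bullet> j) * local_tensor A k c (fst z) i j))"
      by (intro continuous_intros)
    show "(\<Sum>i\<in>Basis. \<Sum>j\<in>Basis. (snd z \<bullet> i) * ((snd z \<bullet> j) * local_tensor A k c (fst z) i j)) =
        local_tensor A k c (fst z) (snd z) (snd z)" if "z \<in> T" for z
      using bilinear_expand[OF local_tensor_bilinear[OF X k c(1)], of "fst z" "snd z" "snd z"]
        that r by (auto simp: T_def V_def)
  qed
  have Gpos: "G x e e > 0" if "x \<in> V" "e \<noteq> 0" for x e
  proof -
    have q: "c \<in> charts_at A (chart_inv c x)" "chart_inv c x \<in> points A"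
      using chart_inv_charts_at[OF c(1)] that by (auto simp: V_def)
    have x: "snd c (chart_inv c x) = x"
      using that chart_inv_right[OF X c(1)] by (auto simp: V_def)
    \<comment> \<open>The transition map from \<open>c\<close> to itself is the identity near \<open>x\<close>, so the \<open>c\<close>-coordinates of
      \<open>tvec_of A c (chart_inv c x) e\<close> are \<open>e\<close>; in particular that tangent vector is nonzero.\<close>
    have id: "transition c c y = y" if "y \<in> V" for y
      using that transition_at[OF X c(1), of _ c] by (auto simp: V_def)
    have "((\<lambda>y. y) has_derivative (\<lambda>y. y)) (at x)" by simp
    then have "(transition c c has_derivative (\<lambda>y. y)) (at x)"
      by (rule has_derivative_transform_within_open[OF _ V(1) that(1)]) (simp add: id)
    from frechet_derivative_at[OF this, symmetric]
    have "tvec_of A c (chart_inv c x) e c = e"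
      using q(1) x by (simp add: tvec_of_def)
    then have "tvec_of A c (chart_inv c x) e \<noteq> tzero"
      using that(2) by (auto simp: tzero_def)
    then show ?thesis
      using pos[OF q(2) tvec_of_tangent[OF X q(1)]] by (simp add: G_def local_tensor_def)
  qed
  have "compact T" unfolding T_def by (intro compact_Times) auto
  moreover have "continuous_on T
      (\<lambda>z. \<bar>H (fst z) (snd z) (snd z)\<bar> / G (fst z) (snd z) (snd z))"
  proof (intro continuous_on_divide continuous_on_rabs ballI)
    show "G (fst z) (snd z) (snd z) \<noteq> 0" if "z \<in> T" for z
      using Gpos[of "fst z" "snd z"] that r by (force simp: T_def)
  qed (use cont[OF g] cont[OF h] in \<open>simp_all add: G_def H_def\<close>)
  ultimately have "bounded ((\<lambda>z. \<bar>H (fst z) (snd z) (snd z)\<bar> / G (fst z) (snd z) (snd z)) ` T)"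
    by (intro compact_imp_bounded compact_continuous_image)
  then obtain K where K: "K > 0"
    "\<And>z. z \<in> T \<Longrightarrow> \<bar>\<bar>H (fst z) (snd z) (snd z)\<bar> / G (fst z) (snd z) (snd z)\<bar> \<le> K"
    unfolding bounded_pos by auto
  have unit: "\<bar>H x e e\<bar> \<le> K * G x e e" if "x \<in> ball (snd c p) r" "norm e = 1" for x e
  proof -
    have "(x, e) \<in> T" using that by (auto simp: T_def)
    moreover have "G x e e > 0" using that r(2) by (intro Gpos) auto
    ultimately show ?thesis using K(2)[of "(x, e)"] by (simp add: field_simps)
  qed
  have all: "\<bar>H x e e\<bar> \<le> K * G x e e" if x: "x \<in> ball (snd c p) r" for x e
  proof -
    have xV: "x \<in> V" using x r(2) by auto
    have hom: "B e e = (norm e)\<^sup>2 * B (sgn e) (sgn e)" if "bilinear B" for B :: "'e \<Rightarrow> 'e \<Rightarrow> real"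
    proof -
      have "norm e *\<^sub>R sgn e = e" by (cases "e = 0") (simp_all add: sgn_div_norm)
      then show ?thesis
        using bilinear_lmul[OF that, of "norm e" "sgn e" e]
          bilinear_rmul[OF that, of "sgn e" "norm e" "sgn e"]
        by (simp add: power2_eq_square)
    qed
    show ?thesis
    proof (cases "e = 0")
      case True
      then show ?thesis using bil[OF xV] by (simp add: bilinear_lzero)
    next
      case False
      then have "\<bar>H x (sgn e) (sgn e)\<bar> \<le> K * G x (sgn e) (sgn e)"
        by (intro unit[OF x]) (simp add: norm_sgn)
      then have "(norm e)\<^sup>2 * \<bar>H x (sgn e) (sgn e)\<bar> \<le> (norm e)\<^sup>2 * (K * G x (sgn e) (sgn e))"
        by (intro mult_left_mono) auto
      then show ?thesis
        unfolding hom[OF bil(1)[OF xV]] hom[OF bil(2)[OF xV]] by (simp add: abs_mult ac_simps)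
    qed
  qed
  define N where "N = {q \<in> topspace (subtopology X (fst c)). snd c q \<in> ball (snd c p) r}"
  have "openin (subtopology X (fst c)) N"
    unfolding N_def
  proof (rule openin_continuous_map_preimage)
    show "continuous_map (subtopology X (fst c)) euclidean (snd c)"
      using X c(1) homeomorphic_imp_continuous_map[of _ _ "snd c"]
      unfolding smooth_manifold_def by (metis continuous_map_in_subtopology)
  qed simp
  then have "openin X N"
    by (rule openin_trans_full[OF _ chart_openin[OF X c(1)]])
  moreover have "p \<in> N"
    using c r p points_eq_topspace by (auto simp: N_def)
  moreover have "\<bar>h q u u\<bar> \<le> K * g q u u" if q: "q \<in> N" and u: "u \<in> tangent_space A q" for q u
  proof -
    have qc: "q \<in> fst c" "snd c q \<in> ball (snd c p) r" using q by (auto simp: N_def)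
    then have "c \<in> charts_at A q" using c(1) by (simp add: charts_at_def)
    then show ?thesis
      using all[OF qc(2), of "u c"] chart_inv_right[OF X c(1) qc(1)] tangent_eq_tvec_of[OF u]
      by (simp add: G_def H_def local_tensor_def)
  qed
  ultimately show ?thesis using K(1) by (intro exI[of _ N] exI[of _ K]) auto
qed

text \<open>
  The sum of the finitely many local constants, increased by \<open>1\<close> for strictness, works everywhere.
\<close>

lemma exists_dominating_multiple:
  assumes comp: "compact_space X"
    and g: "smooth_tensor2 A g" and h: "smooth_tensor2 A h"
    and pos: "\<And>p u. p \<in> points A \<Longrightarrow> u \<in> tangent_space A p \<Longrightarrow> u \<noteq> tzero \<Longrightarrow> g p u u > 0"
  shows "\<exists>K. \<forall>p\<in>points A. \<forall>u\<in>tangent_space A p. u \<noteq> tzero \<longrightarrow> h p u u + K * g p u u > 0"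
proof -
  define bound where "bound = (\<lambda>p N K. openin X N \<and> p \<in> N \<and> 0 \<le> K \<and>
      (\<forall>q\<in>N. \<forall>u\<in>tangent_space A q. \<bar>h q u u\<bar> \<le> K * g q u u))"
  have "\<forall>p\<in>points A. \<exists>N K. bound p N K"
    unfolding bound_def using local_domination[OF g h pos] by blast
  then obtain N K where "\<And>p. p \<in> points A \<Longrightarrow> bound p (N p) (K p)"
    by metis
  then have NK: "openin X (N p)" "p \<in> N p" "0 \<le> K p"
    "\<forall>q\<in>N p. \<forall>u\<in>tangent_space A q. \<bar>h q u u\<bar> \<le> K p * g q u u" if "p \<in> points A" for p
    using that unfolding bound_def by blast+
  have "openin X U" if "U \<in> N ` points A" for U
    using that NK(1) by blast
  moreover have "topspace X \<subseteq> \<Union>(N ` points A)"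
    using NK(2) points_eq_topspace by blast
  ultimately have "\<exists>\<F>. finite \<F> \<and> \<F> \<subseteq> N ` points A \<and> topspace X \<subseteq> \<Union>\<F>"
    using comp[unfolded compact_space_alt, rule_format, of "N ` points A"] by blast
  then obtain F where F: "finite F" "F \<subseteq> points A" "topspace X \<subseteq> \<Union>(N ` F)"
    by (metis finite_subset_image)
  show ?thesis
  proof (intro exI[of _ "1 + sum K F"] ballI impI)
    fix p u assume p: "p \<in> points A" and u: "u \<in> tangent_space A p" "u \<noteq> tzero"
    obtain q where q: "q \<in> F" "p \<in> N q" using F(3) p points_eq_topspace by blast
    have gp: "g p u u > 0" by (rule pos[OF p u])
    have "K q \<le> sum K F"
      using F(1,2) NK(3) q(1) by (intro member_le_sum) auto
    then have "K q * g p u u \<le> sum K F * g p u u"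
      using gp by (intro mult_right_mono) auto
    moreover have "\<bar>h p u u\<bar> \<le> K q * g p u u"
      using NK(4) q F(2) u(1) by blast
    ultimately show "h p u u + (1 + sum K F) * g p u u > 0"
      using gp unfolding distrib_right mult_1_left by linarith
  qed
qed

end


section \<open>The splitting of 2-forms by an almost complex structure\<close>

text \<open>
  The action of \<open>J\<close> on 2-forms; the value \<open>0\<close> off the tangent spaces is the one that membership in
  \<open>Omega2\<close> demands.
\<close>

definition J_pullback ::
    "('m, 'e::euclidean_space) chart set \<Rightarrow> ('m, 'e) endo \<Rightarrow> ('m, 'e) tensor2 \<Rightarrow> ('m, 'e) tensor2" where
  "J_pullback A J \<omega> p u v =
     (if p \<in> points A \<and> u \<in> tangent_space A p \<and> v \<in> tangent_space A p
      then \<omega> p (J p u) (J p v) else 0)"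

context
  fixes X :: "'m topology" and A :: "('m, 'e::euclidean_space) chart set" and J :: "('m, 'e) endo"
  assumes X: "smooth_manifold X A" and J: "almost_complex_structure A J"
begin

lemma J_tangent: "p \<in> points A \<Longrightarrow> u \<in> tangent_space A p \<Longrightarrow> J p u \<in> tangent_space A p"
  and J_J: "p \<in> points A \<Longrightarrow> u \<in> tangent_space A p \<Longrightarrow> J p (J p u) = (\<lambda>c. - u c)"
  and J_tcomb: "p \<in> points A \<Longrightarrow> u \<in> tangent_space A p \<Longrightarrow> v \<in> tangent_space A p \<Longrightarrow>
    J p (tcomb a u b v) = tcomb a (J p u) b (J p v)"
  using J unfolding almost_complex_structure_def by blast+

text \<open>
  In a chart, the coefficient matrix of the new tensor is the product of those of \<open>g\<close> and \<open>J\<close>,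
  both of which are smooth.
\<close>

lemma smooth_tensor2_J_right:
  assumes g: "smooth_tensor2 A g"
  shows "smooth_tensor2 A (\<lambda>p u v. g p u (J p v))"
  unfolding smooth_tensor2_def
proof (intro conjI ballI allI)
  fix p u v w a b
  assume t: "p \<in> points A" "u \<in> tangent_space A p" "v \<in> tangent_space A p" "w \<in> tangent_space A p"
  show "g p (tcomb a u b v) (J p w) = a * g p u (J p w) + b * g p v (J p w)"
    by (rule smooth_tensor2_bilinear(1)[OF g t(1-3) J_tangent[OF t(1,4)]])
  show "g p w (J p (tcomb a u b v)) = a * g p w (J p u) + b * g p w (J p v)"
    unfolding J_tcomb[OF t(1-3)]
    by (rule smooth_tensor2_bilinear(2)[OF g t(1) J_tangent[OF t(1,2)] J_tangent[OF t(1,3)] t(4)])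
next
  fix c a b assume c: "c \<in> A"
  define j where "j = (\<lambda>x. J (chart_inv c x) (tvec_of A c (chart_inv c x) b) c)"
  note V = open_chart_image[OF X c]
  have j: "smooth_on (snd c ` fst c) j"
    using J c unfolding almost_complex_structure_def j_def by blast
  show "smooth_on (snd c ` fst c) (\<lambda>x. local_tensor A (\<lambda>p u v. g p u (J p v)) c x a b)"
  proof (rule smooth_on_cong[OF V])
    show "smooth_on (snd c ` fst c) (\<lambda>x. \<Sum>i\<in>Basis. (j x \<bullet> i) * local_tensor A g c x a i)"
      by (intro smooth_on_sum smooth_on_mult smooth_on_inner V j smooth_tensor2_local g c) simp
    fix x assume x: "x \<in> snd c ` fst c"
    note q = chart_inv_charts_at[OF X c x]
    have lin: "linear (local_tensor A g c x a)"
      using local_tensor_bilinear[OF X g c x] by (simp add: bilinear_def)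
    have "(\<Sum>i\<in>Basis. (j x \<bullet> i) * local_tensor A g c x a i) =
        local_tensor A g c x a (\<Sum>i\<in>Basis. (j x \<bullet> i) *\<^sub>R i)"
      by (simp add: linear_sum[OF lin] linear_scale[OF lin])
    also have "\<dots> = local_tensor A g c x a (j x)"
      by (simp add: euclidean_representation)
    also have "\<dots> = local_tensor A (\<lambda>p u v. g p u (J p v)) c x a b"
      using tangent_eq_tvec_of[OF J_tangent[OF q(2) tvec_of_tangent[OF X q(1)]] q(1), of b]
      by (simp add: local_tensor_def j_def)
    finally show "(\<Sum>i\<in>Basis. (j x \<bullet> i) * local_tensor A g c x a i) =
        local_tensor A (\<lambda>p u v. g p u (J p v)) c x a b" .
  qed
qed

lemma J_pullback_Omega2:
  assumes \<omega>: "\<omega> \<in> Omega2 A"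
  shows "J_pullback A J \<omega> \<in> Omega2 A"
proof -
  have "smooth_tensor2 A (\<lambda>p u v. \<omega> p v (J p u))"
    by (rule smooth_tensor2_flip[where g = "\<lambda>p u v. \<omega> p u (J p v)",
        OF smooth_tensor2_J_right[OF Omega2_smooth[OF \<omega>]]])
  then have "smooth_tensor2 A (\<lambda>p u v. \<omega> p (J p v) (J p u))"
    by (rule smooth_tensor2_J_right[where g = "\<lambda>p u v. \<omega> p v (J p u)"])
  then have "smooth_tensor2 A (\<lambda>p u v. \<omega> p (J p u) (J p v))"
    by (rule smooth_tensor2_flip[where g = "\<lambda>p u v. \<omega> p (J p v) (J p u)"])
  then have "smooth_tensor2 A (J_pullback A J \<omega>)"
    by (rule smooth_tensor2_cong[OF X]) (simp add: J_pullback_def)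
  moreover have "J_pullback A J \<omega> p u v = - J_pullback A J \<omega> p v u"
    if "p \<in> points A" "u \<in> tangent_space A p" "v \<in> tangent_space A p" for p u v
    using Omega2_antisym[OF \<omega> that(1) J_tangent[OF that(1,2)] J_tangent[OF that(1,3)]] that
    by (simp add: J_pullback_def)
  moreover have "J_pullback A J \<omega> p u v = 0"
    if "\<not> (p \<in> points A \<and> u \<in> tangent_space A p \<and> v \<in> tangent_space A p)" for p u v
    unfolding J_pullback_def using that by (simp only: if_False)
  ultimately show ?thesis
    unfolding Omega2_def by blast
qed

lemma J_pullback_J:
  assumes \<omega>: "\<omega> \<in> Omega2 A" and t: "p \<in> points A" "u \<in> tangent_space A p" "v \<in> tangent_space A p"
  shows "J_pullback A J \<omega> p (J p u) (J p v) = \<omega> p u v"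
proof -
  note m = smooth_tensor2_minus[OF Omega2_smooth[OF \<omega>] t(1)]
  have "(\<lambda>c. - v c) \<in> tangent_space A p"
    using J_tangent[OF t(1) J_tangent[OF t(1,3)]] J_J[OF t(1,3)] by simp
  then show ?thesis
    using t J_tangent by (simp add: J_pullback_def J_J m)
qed

text \<open>
  Since \<open>J_pullback\<close> squares to the identity on forms, the half sum and the half difference of \<open>\<omega>\<close> and
  its pullback are the projections to the two eigenspaces.
\<close>

lemma Omega2_split:
  assumes \<omega>: "\<omega> \<in> Omega2 A"
  shows "\<exists>\<sigma>\<in>Omega_plus A J. \<exists>\<alpha>\<in>Omega_minus A J. \<omega> = tensor_comb 1 \<sigma> 1 \<alpha>"
proof -
  define \<sigma> where "\<sigma> = tensor_comb (1/2) \<omega> (1/2) (J_pullback A J \<omega>)"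
  define \<alpha> where "\<alpha> = tensor_comb (1/2) \<omega> (-(1/2)) (J_pullback A J \<omega>)"
  have val: "\<omega> p (J p u) (J p v) = J_pullback A J \<omega> p u v"
    if "p \<in> points A" "u \<in> tangent_space A p" "v \<in> tangent_space A p" for p u v
    unfolding J_pullback_def using that by (simp only: simp_thms if_True)
  have "\<sigma> p (J p u) (J p v) = \<sigma> p u v" "\<alpha> p (J p u) (J p v) = - \<alpha> p u v"
    if t: "p \<in> points A" "u \<in> tangent_space A p" "v \<in> tangent_space A p" for p u v
    unfolding \<sigma>_def \<alpha>_def tensor_comb_def val[OF t] J_pullback_J[OF \<omega> t] by simp_all
  then have "J_invariant A J \<sigma>" "J_antiinvariant A J \<alpha>"
    unfolding J_invariant_def J_antiinvariant_def by blast+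
  then have "\<sigma> \<in> Omega_plus A J" "\<alpha> \<in> Omega_minus A J"
    unfolding Omega_plus_def Omega_minus_def \<sigma>_def \<alpha>_def
    using Omega2_comb[OF X \<omega> J_pullback_Omega2[OF \<omega>]] by blast+
  moreover have "\<omega> = tensor_comb 1 \<sigma> 1 \<alpha>"
    by (simp add: \<sigma>_def \<alpha>_def tensor_comb_def)
  ultimately show ?thesis by blast
qed

text \<open>
  Applying \<open>J\<close> to both arguments of \<open>(u, J u)\<close> gives \<open>(J u, - u)\<close>, on which every form takes the same
  value as on \<open>(u, J u)\<close>; for an anti-invariant form it is also the opposite value.
\<close>

lemma Omega_minus_on_J:
  assumes \<alpha>: "\<alpha> \<in> Omega_minus A J" and t: "p \<in> points A" "u \<in> tangent_space A p"
  shows "\<alpha> p u (J p u) = 0"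
proof -
  have o: "\<alpha> \<in> Omega2 A" using \<alpha> by (simp add: Omega_minus_def)
  note Ju = J_tangent[OF t]
  have "\<alpha> p u (J p u) = - \<alpha> p (J p u) (J p (J p u))"
    using \<alpha> t Ju by (simp add: Omega_minus_def J_antiinvariant_def)
  also have "\<dots> = \<alpha> p (J p u) u"
    using smooth_tensor2_minus(2)[OF Omega2_smooth[OF o] t Ju] by (simp add: J_J[OF t])
  also have "\<dots> = - \<alpha> p u (J p u)"
    by (rule Omega2_antisym[OF o t(1) Ju t(2)])
  finally show ?thesis by simp
qed

text \<open>
  The symmetry of \<open>\<omega>(\<cdot>, J \<cdot>)\<close>, part of being a metric, amounts to the invariance of \<open>\<omega>\<close>.
\<close>

lemma Omega_oplus_eq: "Omega_oplus A J = {\<omega> \<in> Omega_plus A J. J_positive A J \<omega>}"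
proof
  show "{\<omega> \<in> Omega_plus A J. J_positive A J \<omega>} \<subseteq> Omega_oplus A J"
  proof
    fix \<omega> assume "\<omega> \<in> {\<omega> \<in> Omega_plus A J. J_positive A J \<omega>}"
    then have o: "\<omega> \<in> Omega2 A" and inv: "J_invariant A J \<omega>" and pos: "J_positive A J \<omega>"
      by (auto simp: Omega_plus_def)
    have "\<omega> p u (J p v) = \<omega> p v (J p u)"
      if t: "p \<in> points A" "u \<in> tangent_space A p" "v \<in> tangent_space A p" for p u v
    proof -
      note Ju = J_tangent[OF t(1,2)] and Jv = J_tangent[OF t(1,3)]
      have "\<omega> p u (J p v) = \<omega> p (J p u) (J p (J p v))"
        using inv t(1,2) Jv by (simp add: J_invariant_def)
      also have "\<dots> = - \<omega> p (J p u) v"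
        using smooth_tensor2_minus(2)[OF Omega2_smooth[OF o] t(1,3) Ju] by (simp add: J_J[OF t(1,3)])
      also have "\<dots> = \<omega> p v (J p u)"
        using Omega2_antisym[OF o t(1,3) Ju] by simp
      finally show ?thesis .
    qed
    then have "riemannian_metric A (\<lambda>p u v. \<omega> p u (J p v))"
      using smooth_tensor2_J_right[OF Omega2_smooth[OF o]] pos
      unfolding riemannian_metric_def J_positive_def by blast
    then show "\<omega> \<in> Omega_oplus A J" using o by (simp add: Omega_oplus_def)
  qed
qed (rule Omega_oplus_subset[OF J])

lemma Omega_plus_comb:
  "\<sigma> \<in> Omega_plus A J \<Longrightarrow> \<tau> \<in> Omega_plus A J \<Longrightarrow> tensor_comb a \<sigma> b \<tau> \<in> Omega_plus A J"
  by (simp add: Omega_plus_def Omega2_comb[OF X] J_invariant_comb)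

lemma Omega_oplus_Omega2: "\<sigma> \<in> Omega_oplus A J \<Longrightarrow> \<sigma> \<in> Omega2 A"
  by (simp add: Omega_oplus_def)

lemma Omega_oplus_add:
  assumes "\<sigma> \<in> Omega_oplus A J" "\<tau> \<in> Omega_oplus A J"
  shows "tensor_comb 1 \<sigma> 1 \<tau> \<in> Omega_oplus A J"
  using assms Omega_plus_comb[of \<sigma> \<tau> 1 1] unfolding Omega_oplus_eq
  by (simp add: J_positive_def) (simp add: tensor_comb_def add_pos_pos)

text \<open>Nondegeneracy is automatic, with \<open>J u\<close> as the vector pairing nontrivially with \<open>u\<close>.\<close>

lemma symplectic_form_of_closed_positive:
  assumes "\<omega> \<in> Omega2 A" "ext_deriv A \<omega> = (\<lambda>p u v w. 0)" "J_positive A J \<omega>"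
  shows "symplectic_form A \<omega>"
  using assms J_tangent unfolding symplectic_form_def J_positive_def
  by (metis less_irrefl)


section \<open>Taming and compatible forms in terms of exterior derivatives\<close>

lemma ex_tames_iff:
  "(\<exists>\<omega>. tames A J \<omega>) \<longleftrightarrow> ext_deriv A ` Omega_minus A J \<inter> ext_deriv A ` Omega_oplus A J \<noteq> {}"
proof
  assume "\<exists>\<omega>. tames A J \<omega>"
  then obtain \<omega> where o: "\<omega> \<in> Omega2 A" and d: "ext_deriv A \<omega> = (\<lambda>p u v w. 0)"
    and pos: "J_positive A J \<omega>"
    by (auto simp: tames_def symplectic_form_def)
  obtain \<sigma> \<alpha> where \<sigma>: "\<sigma> \<in> Omega_plus A J" and \<alpha>: "\<alpha> \<in> Omega_minus A J"
    and \<omega>: "\<omega> = tensor_comb 1 \<sigma> 1 \<alpha>"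
    using Omega2_split[OF o] by blast
  have o2: "\<sigma> \<in> Omega2 A" "\<alpha> \<in> Omega2 A"
    using \<sigma> \<alpha> by (auto simp: Omega_plus_def Omega_minus_def)
  have "J_positive A J \<sigma>"
    using pos Omega_minus_on_J[OF \<alpha>] by (simp add: J_positive_def \<omega> tensor_comb_def)
  then have so: "\<sigma> \<in> Omega_oplus A J" using \<sigma> by (simp add: Omega_oplus_eq)
  let ?\<beta> = "tensor_comb (-1) \<alpha> 0 \<alpha>"
  have \<beta>: "?\<beta> \<in> Omega_minus A J"
    using \<alpha> Omega2_comb[OF X o2(2) o2(2)]
    by (simp add: Omega_minus_def J_antiinvariant_def) (simp add: tensor_comb_def)
  have "ext_deriv A \<sigma> p u v w + ext_deriv A \<alpha> p u v w = 0" for p u v w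
    using d ext_deriv_comb[OF X o2, of 1 1] by (simp add: \<omega> fun_eq_iff)
  then have "ext_deriv A \<sigma> = ext_deriv A ?\<beta>"
    unfolding ext_deriv_comb[OF X o2(2) o2(2)] by (simp add: fun_eq_iff eq_neg_iff_add_eq_0)
  then have "ext_deriv A \<sigma> \<in> ext_deriv A ` Omega_minus A J"
    using \<beta> by (rule image_eqI)
  then show "ext_deriv A ` Omega_minus A J \<inter> ext_deriv A ` Omega_oplus A J \<noteq> {}"
    using so by blast
next
  assume "ext_deriv A ` Omega_minus A J \<inter> ext_deriv A ` Omega_oplus A J \<noteq> {}"
  then obtain \<alpha> \<sigma> where \<alpha>: "\<alpha> \<in> Omega_minus A J" and \<sigma>: "\<sigma> \<in> Omega_oplus A J"
    and eq: "ext_deriv A \<alpha> = ext_deriv A \<sigma>" by auto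
  have o2: "\<sigma> \<in> Omega2 A" "\<alpha> \<in> Omega2 A"
    using \<sigma> \<alpha> by (auto simp: Omega_oplus_def Omega_minus_def)
  let ?\<omega> = "tensor_comb 1 \<sigma> (-1) \<alpha>"
  have o: "?\<omega> \<in> Omega2 A" by (rule Omega2_comb[OF X o2])
  have pos: "J_positive A J ?\<omega>"
    using \<sigma> Omega_minus_on_J[OF \<alpha>] by (simp add: Omega_oplus_eq J_positive_def tensor_comb_def)
  have "ext_deriv A ?\<omega> = (\<lambda>p u v w. 0)"
    by (simp add: ext_deriv_comb[OF X o2] eq)
  then have "tames A J ?\<omega>"
    using symplectic_form_of_closed_positive[OF o _ pos] pos by (simp add: tames_def)
  then show "\<exists>\<omega>. tames A J \<omega>" by blast
qed

lemma ex_compatible_iff: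
  "(\<exists>\<omega>. compatible A J \<omega>) \<longleftrightarrow> (\<lambda>p u v w. 0) \<in> ext_deriv A ` Omega_oplus A J"
proof
  assume "\<exists>\<omega>. compatible A J \<omega>"
  then obtain \<omega> where "\<omega> \<in> Omega_oplus A J" "ext_deriv A \<omega> = (\<lambda>p u v w. 0)"
    by (auto simp: compatible_def symplectic_form_def Omega_oplus_eq Omega_plus_def)
  then show "(\<lambda>p u v w. 0) \<in> ext_deriv A ` Omega_oplus A J" by force
next
  assume "(\<lambda>p u v w. 0) \<in> ext_deriv A ` Omega_oplus A J"
  then obtain \<omega> where \<omega>: "\<omega> \<in> Omega_oplus A J" "ext_deriv A \<omega> = (\<lambda>p u v w. 0)" by force
  then have "compatible A J \<omega>"
    using symplectic_form_of_closed_positive[OF Omega_oplus_Omega2[OF \<omega>(1)] \<omega>(2)]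
    by (auto simp: compatible_def Omega_oplus_eq Omega_plus_def)
  then show "\<exists>\<omega>. compatible A J \<omega>" by blast
qed

text \<open>
  A closed positive form \<open>\<omega>\<close> can be added to an invariant form in any multiple without changing its
  derivative, and for a large multiple the sum is positive. Conversely, \<open>0 = d 0\<close> lies in \<open>d \<Omega>\<^sup>+\<close>.
\<close>

lemma zero_in_d_oplus_iff:
  assumes comp: "compact_space X"
  shows "(\<lambda>p u v w. 0) \<in> ext_deriv A ` Omega_oplus A J \<longleftrightarrow>
    ext_deriv A ` Omega_oplus A J = ext_deriv A ` Omega_plus A J"
proof
  assume "(\<lambda>p u v w. 0) \<in> ext_deriv A ` Omega_oplus A J"
  then obtain \<omega> where \<omega>: "\<omega> \<in> Omega_oplus A J" and d: "ext_deriv A \<omega> = (\<lambda>p u v w. 0)" by force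
  note o = Omega_oplus_Omega2[OF \<omega>]
  have "ext_deriv A \<alpha> \<in> ext_deriv A ` Omega_oplus A J" if \<alpha>: "\<alpha> \<in> Omega_plus A J" for \<alpha>
  proof -
    have o2: "\<alpha> \<in> Omega2 A" using \<alpha> by (simp add: Omega_plus_def)
    have "\<exists>K. \<forall>p\<in>points A. \<forall>u\<in>tangent_space A p. u \<noteq> tzero \<longrightarrow>
        \<alpha> p u (J p u) + K * \<omega> p u (J p u) > 0"
    proof (rule exists_dominating_multiple[OF X comp, where g = "\<lambda>p u v. \<omega> p u (J p v)"
          and h = "\<lambda>p u v. \<alpha> p u (J p v)"])
      show "smooth_tensor2 A (\<lambda>p u v. \<omega> p u (J p v))" "smooth_tensor2 A (\<lambda>p u v. \<alpha> p u (J p v))"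
        by (rule smooth_tensor2_J_right[OF Omega2_smooth[OF o]]
            smooth_tensor2_J_right[OF Omega2_smooth[OF o2]])+
      show "\<omega> p u (J p u) > 0" if "p \<in> points A" "u \<in> tangent_space A p" "u \<noteq> tzero" for p u
        using \<omega> that by (simp add: Omega_oplus_eq J_positive_def)
    qed
    then obtain K where "J_positive A J (tensor_comb 1 \<alpha> K \<omega>)"
      by (auto simp: J_positive_def tensor_comb_def)
    then have "tensor_comb 1 \<alpha> K \<omega> \<in> Omega_oplus A J"
      using \<omega> \<alpha> Omega_plus_comb by (simp add: Omega_oplus_eq)
    moreover have "ext_deriv A \<alpha> = ext_deriv A (tensor_comb 1 \<alpha> K \<omega>)"
      by (simp add: ext_deriv_comb[OF X o2 o] d)
    ultimately show ?thesis by (rule rev_image_eqI[where f = "ext_deriv A"])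
  qed
  then show "ext_deriv A ` Omega_oplus A J = ext_deriv A ` Omega_plus A J"
    using Omega_oplus_eq by blast
next
  assume eq: "ext_deriv A ` Omega_oplus A J = ext_deriv A ` Omega_plus A J"
  let ?z = "\<lambda>p u v. 0 :: real"
  have "?z \<in> Omega_plus A J"
    by (simp add: Omega_plus_def Omega2_def smooth_tensor2_def local_tensor_def smooth_on_const
        J_invariant_def)
  moreover have "ext_deriv A ?z = (\<lambda>p u v w. 0)"
    using ext_deriv_comb[OF X, of ?z ?z 0 0] calculation
    by (simp add: Omega_plus_def tensor_comb_def)
  ultimately show "(\<lambda>p u v w. 0) \<in> ext_deriv A ` Omega_oplus A J"
    unfolding eq by force
qed

text \<open>The sum of two positive invariant forms is again one.\<close>

lemma d_oplus_opposite:
  assumes "f \<in> ext_deriv A ` Omega_oplus A J" "(\<lambda>p u v w. - f p u v w) \<in> ext_deriv A ` Omega_oplus A J"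
  shows "(\<lambda>p u v w. 0) \<in> ext_deriv A ` Omega_oplus A J"
proof -
  obtain \<sigma> \<tau> where \<sigma>: "\<sigma> \<in> Omega_oplus A J" "f = ext_deriv A \<sigma>"
    and \<tau>: "\<tau> \<in> Omega_oplus A J" "(\<lambda>p u v w. - f p u v w) = ext_deriv A \<tau>"
    using assms by blast
  have "ext_deriv A (tensor_comb 1 \<sigma> 1 \<tau>) = (\<lambda>p u v w. 0)"
    unfolding ext_deriv_comb[OF X Omega_oplus_Omega2[OF \<sigma>(1)] Omega_oplus_Omega2[OF \<tau>(1)]]
      \<sigma>(2)[symmetric] \<tau>(2)[symmetric] by simp
  then show ?thesis
    using Omega_oplus_add[OF \<sigma>(1) \<tau>(1)] by force
qed

lemma d_plus_minus:
  assumes "f \<in> ext_deriv A ` Omega_plus A J"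
  shows "(\<lambda>p u v w. - f p u v w) \<in> ext_deriv A ` Omega_plus A J"
proof -
  obtain \<sigma> where \<sigma>: "\<sigma> \<in> Omega_plus A J" "f = ext_deriv A \<sigma>" using assms by blast
  then have "(\<lambda>p u v. - \<sigma> p u v) \<in> Omega_plus A J"
    using Omega_plus_comb[OF \<sigma>(1) \<sigma>(1), of "-1" 0] by (simp add: tensor_comb_def)
  moreover have "(\<lambda>p u v w. - f p u v w) = ext_deriv A (\<lambda>p u v. - \<sigma> p u v)"
    using \<sigma> by (simp add: ext_deriv_minus[OF X] Omega_plus_def)
  ultimately show ?thesis by (rule rev_image_eqI[where f = "ext_deriv A"])
qed

end

theorem proposition3p3:
  fixes X :: "'m topology"
    and A :: "('m, 'e::euclidean_space) chart set"
    and J :: "('m, 'e) endo"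
    and n :: nat
  assumes "smooth_manifold X A"
    and "compact_space X"
    and "DIM('e) = 2 * n"
    and "almost_complex_structure A J"
  shows
    "(((\<exists>\<omega>. tames A J \<omega>) \<longrightarrow> (\<exists>\<omega>. compatible A J \<omega>)) \<longleftrightarrow>
      (ext_deriv A ` Omega_minus A J \<inter> ext_deriv A ` Omega_oplus A J = {} \<or>
       ext_deriv A ` Omega_oplus A J = ext_deriv A ` Omega_plus A J)) \<and>
     ((ext_deriv A ` Omega_minus A J \<inter> ext_deriv A ` Omega_oplus A J = {} \<or>
       ext_deriv A ` Omega_oplus A J = ext_deriv A ` Omega_plus A J) \<longleftrightarrow>
      (\<forall>\<alpha>\<in>Omega_minus A J.
         ext_deriv A \<alpha> \<in> ext_deriv A ` Omega_oplus A J \<longrightarrow>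
         ext_deriv A (\<lambda>p u v. - \<alpha> p u v) \<in> ext_deriv A ` Omega_oplus A J))"
proof -
  note X = assms(1) and comp = assms(2) and J = assms(4)
  let ?d = "ext_deriv A"
  let ?z = "\<lambda>p u v w. 0"
  let ?b = "?d ` Omega_minus A J \<inter> ?d ` Omega_oplus A J = {} \<or>
    ?d ` Omega_oplus A J = ?d ` Omega_plus A J"
  let ?c = "\<forall>\<alpha>\<in>Omega_minus A J. ?d \<alpha> \<in> ?d ` Omega_oplus A J \<longrightarrow>
    ?d (\<lambda>p u v. - \<alpha> p u v) \<in> ?d ` Omega_oplus A J"
  have ab: "((\<exists>\<omega>. tames A J \<omega>) \<longrightarrow> (\<exists>\<omega>. compatible A J \<omega>)) \<longleftrightarrow> ?b"
    unfolding ex_tames_iff[OF X J] ex_compatible_iff[OF X J] zero_in_d_oplus_iff[OF X J comp]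
    by blast
  have minus: "?d (\<lambda>p u v. - \<alpha> p u v) = (\<lambda>p u v w. - ?d \<alpha> p u v w)"
    if "\<alpha> \<in> Omega_minus A J" for \<alpha>
    using that by (intro ext_deriv_minus[OF X]) (simp add: Omega_minus_def)
  have "?b \<longleftrightarrow> ?c"
  proof
    assume b: ?b
    show ?c
    proof (intro ballI impI)
      fix \<alpha> assume \<alpha>: "\<alpha> \<in> Omega_minus A J" and d: "?d \<alpha> \<in> ?d ` Omega_oplus A J"
      then have "?d ` Omega_oplus A J = ?d ` Omega_plus A J" using b by blast
      with d_plus_minus[OF X J, of "?d \<alpha>"] d
      show "?d (\<lambda>p u v. - \<alpha> p u v) \<in> ?d ` Omega_oplus A J"
        by (simp only: minus[OF \<alpha>])
    qed
  next
    assume c: ?c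
    show ?b
    proof (cases "?d ` Omega_minus A J \<inter> ?d ` Omega_oplus A J = {}")
      case False
      then obtain \<alpha> where \<alpha>: "\<alpha> \<in> Omega_minus A J" and d: "?d \<alpha> \<in> ?d ` Omega_oplus A J"
        by blast
      then have "(\<lambda>p u v w. - ?d \<alpha> p u v w) \<in> ?d ` Omega_oplus A J"
        using c minus[OF \<alpha>] by metis
      then have "?z \<in> ?d ` Omega_oplus A J"
        by (rule d_oplus_opposite[OF X J d])
      then show ?thesis
        unfolding zero_in_d_oplus_iff[OF X J comp] by (rule disjI2)
    qed (rule disjI1)
  qed
  with ab show ?thesis by (rule conjI)
qed

end
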